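(* Let $q$ be an odd prime power and $(\mathrm{Sp}(V),\mathrm O(W,B))$ a dual pair over $\mathbb F_q$. Let $\eta^V_{W,B}$, $\zeta^{W,B}_V$ and the virtual representations $\widetilde{\omega^{\mathrm{top}}}[V\otimes W]$, $\widetilde{\omega^{\mathrm{top}'}}[V\otimes W]$ of $\mathrm{Sp}(V)\times\mathrm O(W,B)$ be as defined in the context. (1) Suppose the pair is in the symplectic metastable range, and let $\pi$ be an irreducible representation of $\mathrm O(W,B)$ such that $\eta^V_{W,B}(\pi)$ is non-zero. Then for every $g\in\mathrm{Sp}(V)$, $$\chi_{\eta^V_{W,B}(\pi)}(g)=\sum_{(h)\in \mathrm O(W,B)}\frac{|(h)|}{|\mathrm O(W,B)|}\cdot\overline{\chi_\pi(h)}\cdot\chi_{\widetilde{\omega^{\mathrm{top}}}[V\otimes W]}(g\otimes h),$$ the sum being over conjugacy classes $(h)$ of $\mathrm O(W,B)$. (2) Suppose the pair is in the orthogonal metastable range, and let $\rho$ be an irreducible representation of $\mathrm{Sp}(V)$ such that $\zeta^{W,B}_V(\rho)$ is non-zero. Then for every $h\in\mathrm O(W,B)$, $$\chi_{\zeta^{W,B}_V(\rho)}(h)=\sum_{(g)\in\mathrm{Sp}(V)}\frac{|(g)|}{|\mathrm{Sp}(V)|}\cdot\overline{\chi_\rho(g)}\cdot\chi_{\widetilde{\omega^{\mathrm{top}'}}[V\otimes W]}(g\otimes h),$$ the sum being over conjugacy classes $(g)$ of $\mathrm{Sp}(V)$.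
   Context: **Notation.** $\chi_\tau$ is the character of a (virtual) representation $\tau$; $g\otimes h$ is the element $(g,h)\in\mathrm{Sp}(V)\times\mathrm O(W,B)$; $|(h)|$ is the size of a conjugacy class; $\widehat G$ is the set of irreducible complex representations of $G$. $\dim V=2N$. $\mathrm{disc}(B)\in\{\pm1\}$ is the quadratic character of the discriminant. **Ranges.** Symplectic metastable: $m<N<2m+1$ if $\dim W=2m+1$; $m\le N<2m$ if $\dim W=2m$. Orthogonal metastable: $m<2N\le2m$ if $\dim W=2m+1$; $m<2N<2m$ if $\dim W=2m$ and $B$ is completely split; $m-1<2N<2m$ if $\dim W=2m$ and $B$ is not completely split. **Virtual top parts.** With $\boldsymbol\eta^V_{W,B}:\widehat{\mathrm O(W,B)}\to K(\mathrm{Rep}(\mathrm{Sp}(V)))$ and $\boldsymbol\zeta^{W,B}_V:\widehat{\mathrm{Sp}(V)}\to K(\mathrm{Rep}(\mathrm O(W,B)))$ the virtual eta and zeta correspondences (defined at the end of this context, under the heading "Virtual correspondences"), $$\widetilde{\omega^{\mathrm{top}}}[V\otimes W]=\bigoplus_{\pi\in\widehat{\mathrm O(W,B)}}\boldsymbol\eta^V_{W,B}(\pi)\otimes\pi,\qquad\widetilde{\omega^{\mathrm{top}'}}[V\otimes W]=\bigoplus_{\rho\in\widehat{\mathrm{Sp}(V)}}\rho\otimes\boldsymbol\zeta^{W,B}_V(\rho).$$ **Symbols.** A symbol is a pair of strictly increasing finite sequences of non-negative integers $\binom{\lambda_1<\dots<\lambda_a}{\mu_1<\dots<\mu_b}$,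 $(\lambda_1,\mu_1)\ne(0,0)$, up to exchanging rows. Symbols with $a-b$ odd and $\sum\lambda_i+\sum\mu_i=r+\frac{(a+b-1)^2}4$ index the irreducible unipotent representations of $\mathrm{Sp}_{2r}(\mathbb F_q)$ and $\mathrm{SO}_{2r+1}(\mathbb F_q)$; symbols with $a-b\equiv0$ (resp. $2$) mod $4$ and $\sum\lambda_i+\sum\mu_i=r+\frac{(a+b)(a+b-2)}4$ index those of $\mathrm{SO}^+_{2r}(\mathbb F_q)$ (resp. $\mathrm{SO}^-_{2r}(\mathbb F_q)$). A symbol with equal rows is degenerate. **Classification data.** For $G=\mathrm{Sp}_{2N}$, $\mathrm{SO}_{2m+1}$, $\mathrm{SO}_{2m}^\pm$ with dual $G^*=\mathrm{SO}_{2N+1}$, $\mathrm{Sp}_{2m}$, $\mathrm{SO}_{2m}^\pm$, irreducible representations are parametrized (Lusztig) by a semisimple class $(s)$ in $G^*(\mathbb F_q)$, a unipotent irreducible representation $u$ of the dual of the identity component $Z(s)^\circ$ of its centralizer and, for $\mathrm{Sp}_{2N}$, a central sign $\pm1$ when $-1$ is an eigenvalue of $s$ with non-degenerate symbol in $u$: written $r^G[(s),u]$, $r^G[(s),u,\pm1]$. The eigenvalues $1$ and $-1$ of $s$ contribute to $Z(s)^\circ$ factors $\mathrm{Sp}_{2p}\times\mathrm{Sp}_{2\ell}$ ($G^*=\mathrm{Sp}_{2m}$), $\mathrm{SO}_{2p+1}\times\mathrm{SO}_{2\ell}^\pm$ ($G^*=\mathrm{SO}_{2N+1}$), $\mathrm{SO}_{2p}^\pm\times\mathrm{SO}_{2\ell}^\pm$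 ($G^*=\mathrm{SO}_{2m}^\pm$). Irreducible representations of $\mathrm O_{2m+1}=\mu_2\times\mathrm{SO}_{2m+1}$ are $r[(s),u]^{\pm1}=(\pm1)\otimes r^{\mathrm{SO}_{2m+1}}[(s),u]$. Those of $\mathrm O_{2m}^\pm$ are $r[(s),u]^\gamma$ with $(s)$ an $\mathrm O_{2m}^\pm$-class in $\mathrm{SO}_{2m}^\pm$ and extension data $\gamma$: a sign for each of the eigenvalues $1,-1$ of $s$ occurring with non-degenerate symbol (a fixed non-canonical labelling). For $s$ in a torus $\prod\mathrm{SO}_2^\pm(\mathbb F_{q^{n_i}})\cong\prod\mu_{q^{n_i}\mp1}$, $\epsilon(s)$ is the product of quadratic characters of its coordinates. $\widetilde{u_{H^*}}$ is the unipotent representation of $H$ corresponding to the unipotent representation $u_{H^*}$ of the dual $H^*$. **$\eta^V_{W,B}(\pi)$, $\dim W=2m+1$.** $\pi=r[(s),u]^{\pm1}$; $Z(s)=H\times\mathrm{Sp}_{2\ell}$ (last factor from $-1$); $u=u_{H^*}\otimes\binom{\lambda_1<\dots<\lambda_a}{\mu_1<\dots<\mu_b}$ with $a-b\equiv1$ mod $4$; $N'=N-m+\frac{a+b-1}2$; $\phi^\pm(s)\in\mathrm{SO}_{2N+1}$ is $s$ with $2(N-m)$ eigenvalues $-1$ and one eigenvalue $1$ added so that $Z(\phi^\pm(s))^\circ=H^*\times\mathrm{SO}^\pm_{2(N-m+\ell)}$; $\phi^-(u)$ (resp. $\phi^+(u)$) is $\widetilde{u_{H^*}}$ tensored with the symbol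 obtained by appending $N'$ to the $\lambda$-row (resp. $\mu$-row), constructible iff $N'$ exceeds the largest entry of that row. $\eta^V_{W,B}(\pi)=r^{\mathrm{Sp}(V)}[(\phi^\pm(s)),\phi^\pm(u),\epsilon(s)\mathrm{disc}(B)]$ (sign that of $\pi$) if constructible, $0$ otherwise. **$\eta^V_{W,B}(\pi)$, $\dim W=2m$.** $\phi(s)=s\oplus I_{2(N-m)+1}$. If $s$ has no eigenvalue $1$, $\phi(u)=\widetilde u\otimes1$. Otherwise $Z(s)^\circ=H\times\mathrm{SO}_{2p}^\pm$ (last factor from $1$), $u=u_{H^*}\otimes\binom{\lambda_1<\dots<\lambda_a}{\mu_1<\dots<\mu_b}$, rows ordered so that $a>b$ or, if $a=b$, $\lambda_i>\mu_i$ for the maximal $i$ with $\lambda_i\neq\mu_i$; $N'=N-m+\frac{a+b}2$; $\phi^-(u)$, $\phi^+(u)$ are defined by appending $N'$ to the $\lambda$-row, $\mu$-row respectively, constructible iff $N'$ exceeds the largest entry of that row. $\eta^V_{W,B}(\pi)=r^{\mathrm{Sp}(V)}[(\phi(s)),\phi^\alpha(u),\beta]$, with $\alpha,\beta$ the extension signs of $\pi$ at eigenvalues $1,-1$ (omitted if absent), if constructible; $0$ otherwise. **$\zeta^{W,B}_V(\rho)$, $\dim W=2m+1$.** $\rho$ has data $(s),u$ and possibly a central sign; $Z(s)^\circ=H\times\mathrm{SO}_{2\ell}^\pm$ (last factor from $-1$); $\widetilde s$ is $s$ with one eigenvalue $1$ removed; $\psi(s)=\widetilde s\oplus(-I)_{2(m-N)}\in\mathrm{Sp}_{2m}$;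 $u=u_{H^*}\otimes\binom{\lambda_1<\dots<\lambda_a}{\mu_1<\dots<\mu_b}$, rows ordered so that $a>b$ or, if $a=b$, $\lambda_i>\mu_i$ for the maximal $i$ with $\lambda_i\neq\mu_i$; new coordinate $N'=m'_\rho=m-N+\frac{a+b}2$. If $\ell=0$, $\psi(u)=\widetilde{u_{H^*}}\otimes1$; if $\ell>0$, $\psi^+(u)$, $\psi^-(u)$ append $m'_\rho$ to the $\lambda$-row, $\mu$-row respectively, the sign being the central sign of $\rho$; constructible iff $m'_\rho$ exceeds the largest entry of that row. $\zeta^{W,B}_V(\rho)=r^{\mathrm O(W,B)}[(\psi(s)),\psi^{(\pm)}(u)]^{\epsilon(s)\mathrm{disc}(B)}$ if constructible, $0$ otherwise. **$\zeta^{W,B}_V(\rho)$, $\dim W=2m$.** $\rho$ has data $(s),u$ and possibly a central sign; $\widetilde s$ is $s$ with one eigenvalue $1$ removed; $Z(s)^\circ=H\times\mathrm{SO}_{2p+1}$ (last factor from $1$); $\psi(s)=\widetilde s\oplus I_{2(m-N)}\in\mathrm{SO}(W,B)$ with $Z(\psi(s))^\circ=H^*\times\mathrm{SO}^\sigma_{2(m-N+p)}$, $\sigma$ a determined sign; $u=u_{H^*}\otimes\binom{\lambda_1<\dots<\lambda_a}{\mu_1<\dots<\mu_b}$ with $a-b\equiv1$ mod $4$; $N'=m'_\rho=m-N+\frac{a+b-1}2$. $\psi^+(u)$ appends $m'_\rho$ to the $\mu$-row, $\psi^-(u)$ to the $\lambda$-row, constructible iff $m'_\rho$ exceeds its largest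 entry. $\alpha(-)=+1$; $\alpha(+)=+1$ unless $a=b+1$, $m'_\rho\le\lambda_a$ and $\mu_i>\lambda_{i+1}$ for the maximal $i$ with $\lambda_{i+1}\ne\mu_i$, when $\alpha(+)=-1$. $\zeta^{W,B}_V(\rho)=r^{\mathrm O(W,B)}[(\psi(s)),\psi^\sigma(u)]^\gamma$, $\gamma$ having sign $\alpha(\sigma)$ at eigenvalue $1$ and the central sign of $\rho$ at eigenvalue $-1$ (if it occurs), if constructible; $0$ otherwise. **Virtual correspondences.** Consider the unipotent datum entering the definition of $\eta^V_{W,B}(\pi)$ (namely $\phi^\pm(u)$ if $\dim W$ is odd, $\phi^\alpha(u)$ or $\phi(u)$ if $\dim W$ is even), respectively of $\zeta^{W,B}_V(\rho)$ (namely $\psi^{(\pm)}(u)$ if $\dim W$ is odd, $\psi^\sigma(u)$ if $\dim W$ is even). If it is constructible, i.e. the new coordinate $N'$ exceeds the largest entry of the row to which it is appended (or the datum is $\widetilde u\otimes1$, respectively $\widetilde{u_{H^*}}\otimes1$, in the cases where no coordinate is appended), put $\boldsymbol\eta^V_{W,B}(\pi)=\eta^V_{W,B}(\pi)$, respectively $\boldsymbol\zeta^{W,B}_V(\rho)=\zeta^{W,B}_V(\rho)$. Otherwise, arrange the rows of the altered symbol so that the new coordinate $N'$ would be appended to the top row $\lambda_1<\dots<\lambda_a$, and let $i\le a$ be such that $\lambda_{i-1}<N'\le\lambda_i$ (with no lower bound if $i=1$). If $N'=\lambda_i$ the virtual correspondence is $0$. If $N'<\lambda_i$, complete the same construction of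 $\eta^V_{W,B}(\pi)$, respectively $\zeta^{W,B}_V(\rho)$, using the symbol $\binom{\lambda_1<\dots<\lambda_{i-1}<N'<\lambda_i<\dots<\lambda_a}{\mu_1<\dots<\mu_b}$; the virtual correspondence is $(-1)^{a-i+1}$ times the resulting irreducible representation. *)

theory Defs
  imports
    "HOL-Algebra.Algebraic_Closure_Type"
    "HOL-Algebra.Free_Abelian_Groups"
    "HOL-Library.Cardinality"
    "HOL-Library.Multiset"
    "HOL-Library.Uprod"
    "Jordan_Normal_Form.Char_Poly"
begin

section \<open>Complex representations of finite groups\<close>

text \<open>A matrix representation is a degree with a matrix-valued map; values outside the carrier are
  irrelevant, so representations are always considered through their isomorphism classes.\<close>

type_synonym 'g rep = "nat \<times> ('g \<Rightarrow> complex mat)"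

definition is_rep :: "('g, 'b) monoid_scheme \<Rightarrow> 'g rep \<Rightarrow> bool" where
  "is_rep G R \<longleftrightarrow> (case R of (d, r) \<Rightarrow>
     (\<forall>g\<in>carrier G. r g \<in> carrier_mat d d) \<and> r \<one>\<^bsub>G\<^esub> = 1\<^sub>m d \<and>
     (\<forall>g\<in>carrier G. \<forall>h\<in>carrier G. r (g \<otimes>\<^bsub>G\<^esub> h) = r g * r h))"

definition invariant_subspace :: "('g, 'b) monoid_scheme \<Rightarrow> 'g rep \<Rightarrow> complex vec set \<Rightarrow> bool" where
  "invariant_subspace G R U \<longleftrightarrow> (case R of (d, r) \<Rightarrow>
     U \<subseteq> carrier_vec d \<and> 0\<^sub>v d \<in> U \<and> (\<forall>u\<in>U. \<forall>v\<in>U. u + v \<in> U) \<and>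
     (\<forall>c. \<forall>u\<in>U. c \<cdot>\<^sub>v u \<in> U) \<and> (\<forall>g\<in>carrier G. \<forall>u\<in>U. r g *\<^sub>v u \<in> U))"

definition irreducible_rep :: "('g, 'b) monoid_scheme \<Rightarrow> 'g rep \<Rightarrow> bool" where
  "irreducible_rep G R \<longleftrightarrow> is_rep G R \<and> 0 < fst R \<and>
     (\<forall>U. invariant_subspace G R U \<longrightarrow> U = {0\<^sub>v (fst R)} \<or> U = carrier_vec (fst R))"

definition iso_class :: "('g, 'b) monoid_scheme \<Rightarrow> 'g rep \<Rightarrow> 'g rep set" where
  "iso_class G R = {R'. is_rep G R' \<and> fst R' = fst R \<and>
     (\<exists>P \<in> carrier_mat (fst R) (fst R). invertible_mat P \<and>
        (\<forall>g\<in>carrier G. P * snd R g = snd R' g * P))}"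

definition Irr :: "('g, 'b) monoid_scheme \<Rightarrow> 'g rep set set" where
  "Irr G = {iso_class G R | R. irreducible_rep G R}"

definition mat_trace :: "'a::comm_monoid_add mat \<Rightarrow> 'a" where
  "mat_trace A = (\<Sum>i<dim_row A. A $$ (i, i))"

definition class_char :: "'g rep set \<Rightarrow> 'g \<Rightarrow> complex" where
  "class_char c g = mat_trace (snd (SOME R. R \<in> c) g)"

text \<open>A virtual representation is an integral combination of isomorphism classes of irreducible
  representations, that is, an element of the free abelian group on \<open>Irr G\<close>.\<close>

type_synonym 'g virtual_rep = "'g rep set \<Rightarrow>\<^sub>0 int"

definition virtual_char :: "'g virtual_rep \<Rightarrow> 'g \<Rightarrow> complex" ("\<chi>") where
  "\<chi> x g = (\<Sum>c \<in> Poly_Mapping.keys x. of_int (Poly_Mapping.lookup x c) * class_char c g)"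

definition kronecker :: "'a::times mat \<Rightarrow> 'a mat \<Rightarrow> 'a mat" where
  "kronecker A B = mat (dim_row A * dim_row B) (dim_col A * dim_col B)
     (\<lambda>(i, j). A $$ (i div dim_row B, j div dim_col B) * B $$ (i mod dim_row B, j mod dim_col B))"

definition tensor_rep :: "'g rep \<Rightarrow> 'h rep \<Rightarrow> ('g \<times> 'h) rep" where
  "tensor_rep R S = (fst R * fst S, \<lambda>(g, h). kronecker (snd R g) (snd S h))"

definition tensor_class ::
  "('g, 'b) monoid_scheme \<Rightarrow> ('h, 'c) monoid_scheme \<Rightarrow> 'g rep set \<Rightarrow> 'h rep set \<Rightarrow> ('g \<times> 'h) rep set"
where
  "tensor_class G H c d = iso_class (G \<times>\<times> H) (tensor_rep (SOME R. R \<in> c) (SOME S. S \<in> d))"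

definition virtual_tensor ::
  "('g, 'b) monoid_scheme \<Rightarrow> ('h, 'c) monoid_scheme \<Rightarrow> 'g virtual_rep \<Rightarrow> 'h virtual_rep
     \<Rightarrow> ('g \<times> 'h) virtual_rep"
where
  "virtual_tensor G H x y =
     frag_extend (\<lambda>c. frag_extend (\<lambda>d. frag_of (tensor_class G H c d)) y) x"

definition conj_class :: "('g, 'b) monoid_scheme \<Rightarrow> 'g \<Rightarrow> 'g set" where
  "conj_class G x = {g \<otimes>\<^bsub>G\<^esub> x \<otimes>\<^bsub>G\<^esub> inv\<^bsub>G\<^esub> g | g. g \<in> carrier G}"

definition conj_classes :: "('g, 'b) monoid_scheme \<Rightarrow> 'g set set" where
  "conj_classes G = conj_class G ` carrier G"

definition elt :: "'a set \<Rightarrow> 'a" where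
  "elt C = (SOME x. x \<in> C)"

section \<open>Symplectic and orthogonal groups\<close>

text \<open>A bilinear form is given by its Gram matrix.\<close>

definition isometry_group :: "'f::field mat \<Rightarrow> 'f mat monoid" where
  "isometry_group F = \<lparr>carrier = {A \<in> carrier_mat (dim_row F) (dim_row F). A\<^sup>T * F * A = F},
     monoid.mult = (*), one = 1\<^sub>m (dim_row F)\<rparr>"

definition special_isometry_group :: "'f::field mat \<Rightarrow> 'f mat monoid" where
  "special_isometry_group F =
     \<lparr>carrier = {A \<in> carrier_mat (dim_row F) (dim_row F). A\<^sup>T * F * A = F \<and> det A = 1},
      monoid.mult = (*), one = 1\<^sub>m (dim_row F)\<rparr>"

text \<open>Skew-symmetric is the same as alternating here, because the characteristic will be odd.\<close>

definition symplectic_form :: "nat \<Rightarrow> 'f::field mat \<Rightarrow> bool" where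
  "symplectic_form N J \<longleftrightarrow> J \<in> carrier_mat (2 * N) (2 * N) \<and> J\<^sup>T = - J \<and> det J \<noteq> 0"

definition symmetric_form :: "nat \<Rightarrow> 'f::field mat \<Rightarrow> bool" where
  "symmetric_form n B \<longleftrightarrow> B \<in> carrier_mat n n \<and> B\<^sup>T = B \<and> det B \<noteq> 0"

definition disc :: "'f::field mat \<Rightarrow> int" where
  "disc B = (if \<exists>x. det B = x ^ 2 then 1 else - 1)"

text \<open>The forms defining the dual groups: \<open>Sp\<^sub>2\<^sub>m\<close> is dual to \<open>SO\<^sub>2\<^sub>m\<^sub>+\<^sub>1\<close>, and
  \<open>SO\<^sub>2\<^sub>N\<^sub>+\<^sub>1\<close> is dual to \<open>Sp\<^sub>2\<^sub>N\<close>.  All non-degenerate symmetric forms of a given odd rank over a finite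
  field are proportional up to isometry, so any of them gives the same odd orthogonal group.\<close>

definition std_symplectic :: "nat \<Rightarrow> 'f::field mat" where
  "std_symplectic m = mat (2 * m) (2 * m)
     (\<lambda>(i, j). if j = i + m then 1 else if i = j + m then - 1 else 0)"

definition std_odd_orthogonal :: "nat \<Rightarrow> 'f::field mat" where
  "std_odd_orthogonal N = mat (2 * N + 1) (2 * N + 1) (\<lambda>(i, j). if i + j = 2 * N then 1 else 0)"

section \<open>Semisimple elements\<close>

definition char_poly_ac :: "'f::field mat \<Rightarrow> 'f alg_closure poly" where
  "char_poly_ac s = map_poly to_ac (char_poly s)"

definition semisimple :: "'f::field mat \<Rightarrow> bool" where
  "semisimple s \<longleftrightarrow> (\<exists>D. diagonal_mat D \<and> similar_mat (map_mat to_ac s :: 'f alg_closure mat) D)"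

definition semisimple_classes :: "'f::field mat monoid \<Rightarrow> 'f mat monoid \<Rightarrow> 'f mat set set" where
  "semisimple_classes G H = conj_class G ` {s \<in> carrier H. semisimple s}"

definition eig_mult :: "'f::field mat \<Rightarrow> 'f \<Rightarrow> nat" where
  "eig_mult s c = Polynomial.order c (char_poly s)"

text \<open>Type of the even-dimensional \<open>c\<close>-eigenspace of a semisimple isometry \<open>s\<close> of the form \<open>F\<close>:
  \<open>1\<close> if it is completely split, i.e. contains a totally isotropic subspace of half its dimension
  (spanned by the columns of \<open>E\<close>), and \<open>-1\<close> otherwise.\<close>

definition eig_type :: "'f::field mat \<Rightarrow> 'f mat \<Rightarrow> 'f \<Rightarrow> int" where
  "eig_type F s c = (let l = eig_mult s c div 2 in
     if \<exists>E \<in> carrier_mat (dim_row F) l. (\<forall>v \<in> carrier_vec l. E *\<^sub>v v = 0\<^sub>v (dim_row F) \<longrightarrow> v = 0\<^sub>v l) \<and>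
          s * E = c \<cdot>\<^sub>m E \<and> E\<^sup>T * F * E = 0\<^sub>m l l
     then 1 else - 1)"

definition completely_split :: "nat \<Rightarrow> 'f::field mat \<Rightarrow> bool" where
  "completely_split m B \<longleftrightarrow>
     (\<exists>E \<in> carrier_mat (2 * m) m. (\<forall>v \<in> carrier_vec m. E *\<^sub>v v = 0\<^sub>v (2 * m) \<longrightarrow> v = 0\<^sub>v m) \<and>
        E\<^sup>T * B * E = 0\<^sub>m m m)"

text \<open>A list of triples \<open>(k, \<sigma>, x)\<close> stands for an element of the torus \<open>\<Prod> SO\<^sub>2\<^sup>\<sigma>(F\<^sub>Q)\<close>, \<open>Q = q\<^sup>k\<close>, of the
  isometry group of \<open>F\<close>; the coordinate \<open>x\<close> lies in the group of roots of unity of order \<open>Q - \<sigma>\<close>.  On the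
  natural module the coordinate has the eigenvalues \<open>x\<close> and \<open>1/x\<close> and their conjugates; if the
  dimension is odd there is one more eigenvalue \<open>1\<close>.  In a symplectic group this determines the
  semisimple class; in an odd orthogonal group one also needs the type of the \<open>-1\<close>-eigenspace, which
  is the product of the types of the factors where \<open>x = -1\<close>.\<close>

definition torus_coords ::
  "'f::{field,finite} mat \<Rightarrow> 'f mat \<Rightarrow> (nat \<times> int \<times> 'f alg_closure) list \<Rightarrow> bool"
where
  "torus_coords F s xs \<longleftrightarrow>
     (\<forall>(k, \<sigma>, x) \<in> set xs. 0 < k \<and> \<sigma> \<in> {1, - 1} \<and> x ^ nat (int (CARD('f) ^ k) - \<sigma>) = 1) \<and>
     char_poly_ac s = [:- 1, 1:] ^ (dim_row F mod 2) *
       (\<Prod>(k, \<sigma>, x) \<leftarrow> xs. \<Prod>j<k. [:- (x ^ CARD('f) ^ j), 1:] * [:- (inverse x ^ CARD('f) ^ j), 1:]) \<and>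
     (odd (dim_row F) \<longrightarrow> (\<Prod>(k, \<sigma>, x) \<leftarrow> filter (\<lambda>(k, \<sigma>, x). x = - 1) xs. \<sigma>) = eig_type F s (- 1))"

text \<open>The possible values of \<open>\<epsilon>(s)\<close>.  The value is unique except for a symplectic \<open>s\<close> with eigenvalue
  \<open>-1\<close>, where it depends on the torus containing \<open>s\<close>.\<close>

definition torus_sign :: "'f::{field,finite} mat \<Rightarrow> 'f mat \<Rightarrow> int \<Rightarrow> bool" where
  "torus_sign F s e \<longleftrightarrow> (\<exists>xs. torus_coords F s xs \<and>
     e = (\<Prod>(k, \<sigma>, x) \<leftarrow> xs. if x ^ (nat (int (CARD('f) ^ k) - \<sigma>) div 2) = 1 then 1 else - 1))"

section \<open>Symbols\<close>

type_synonym symbol = "nat list uprod"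

definition symbol_rows :: "nat list \<Rightarrow> nat list \<Rightarrow> bool" where
  "symbol_rows A B \<longleftrightarrow> sorted_wrt (<) A \<and> sorted_wrt (<) B \<and>
     \<not> (A \<noteq> [] \<and> B \<noteq> [] \<and> hd A = 0 \<and> hd B = 0)"

text \<open>Symbols of the unipotent representations of \<open>Sp\<^sub>2\<^sub>r\<close> and \<open>SO\<^sub>2\<^sub>r\<^sub>+\<^sub>1\<close>.\<close>

definition odd_symbols :: "nat \<Rightarrow> symbol set" where
  "odd_symbols r = {Upair A B | A B. symbol_rows A B \<and>
     odd (int (length A) - int (length B)) \<and>
     sum_list A + sum_list B = r + (length A + length B - 1) ^ 2 div 4}"

text \<open>Symbols of the unipotent representations of \<open>SO\<^sub>2\<^sub>r\<close> of type \<open>\<sigma>\<close>.\<close>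

definition even_symbols :: "int \<Rightarrow> nat \<Rightarrow> symbol set" where
  "even_symbols \<sigma> r = {Upair A B | A B. symbol_rows A B \<and>
     (int (length A) - int (length B)) mod 4 = (if \<sigma> = 1 then 0 else 2) \<and>
     sum_list A + sum_list B = r + (length A + length B) * (length A + length B - 2) div 4}"

definition degenerate :: "symbol \<Rightarrow> bool" where
  "degenerate S \<longleftrightarrow> (\<exists>A. S = Upair A A)"

definition odd_rows :: "symbol \<Rightarrow> nat list \<times> nat list" where
  "odd_rows S = (THE (A, B). S = Upair A B \<and> (int (length A) - int (length B)) mod 4 = 1)"

definition last_difference_greater :: "nat list \<Rightarrow> nat list \<Rightarrow> bool" where
  "last_difference_greater A B \<longleftrightarrow>
     (\<exists>i < length B. A ! i > B ! i \<and> (\<forall>j. i < j \<and> j < length B \<longrightarrow> A ! j = B ! j))"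

definition even_rows :: "symbol \<Rightarrow> nat list \<times> nat list" where
  "even_rows S = (THE (A, B). S = Upair A B \<and>
     (length A > length B \<or> length A = length B \<and> (A = B \<or> last_difference_greater A B)))"

section \<open>Classification data\<close>

text \<open>A unipotent representation attached to a semisimple \<open>s\<close>: the factors of the centralizer from
  the eigenvalues \<open>1\<close> and \<open>-1\<close> carry a symbol; those from the other eigenvalues are general linear
  or unitary groups over extension fields, whose unipotent representations are indexed by partitions
  of their rank, the multiplicity of the eigenvalue.  Such a factor corresponds to an orbit of
  eigenvalues under Frobenius and inversion.  Corresponding unipotent representations of dual
  groups have the same datum.\<close>

datatype 'x unipotent =
  Unipotent (unip_parts: "'x \<Rightarrow> nat multiset") (unip_one: symbol) (unip_minus: symbol)

definition with_one :: "'x unipotent \<Rightarrow> symbol \<Rightarrow> 'x unipotent" where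
  "with_one u S = Unipotent (unip_parts u) S (unip_minus u)"

definition with_minus :: "'x unipotent \<Rightarrow> symbol \<Rightarrow> 'x unipotent" where
  "with_minus u S = Unipotent (unip_parts u) (unip_one u) S"

definition parts_ok :: "'f::{field,finite} mat \<Rightarrow> ('f alg_closure \<Rightarrow> nat multiset) \<Rightarrow> bool" where
  "parts_ok s \<nu> \<longleftrightarrow> (\<forall>x.
     (if x = 1 \<or> x = - 1 then \<nu> x = {#}
      else 0 \<notin># \<nu> x \<and> sum_mset (\<nu> x) = Polynomial.order x (char_poly_ac s)) \<and>
     \<nu> (x ^ CARD('f)) = \<nu> x \<and> \<nu> (inverse x) = \<nu> x)"

definition sign_ok :: "symbol \<Rightarrow> int option \<Rightarrow> bool" where
  "sign_ok S e \<longleftrightarrow> (if degenerate S then e = None else e \<in> {Some 1, Some (- 1)})"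

definition sign_if_nondegenerate :: "symbol \<Rightarrow> int \<Rightarrow> int option" where
  "sign_if_nondegenerate S e = (if degenerate S then None else Some e)"

text \<open>An eigenvalue that does not occur has the empty symbol (or the trivial odd one), so that no
  sign is attached to it.\<close>

type_synonym ('f, 'x) sp_label = "'f mat set \<times> 'x unipotent \<times> int option"
type_synonym ('f, 'x) so_label = "'f mat set \<times> 'x unipotent"
type_synonym ('f, 'x) o_label = "'f mat set \<times> 'x unipotent \<times> int option \<times> int option"

text \<open>Data \<open>(s), u\<close> and central sign for \<open>Sp\<^sub>2\<^sub>N\<close>.\<close>

definition sp_labels :: "nat \<Rightarrow> ('f::{field,finite}, 'f alg_closure) sp_label set" where
  "sp_labels N = (let F = std_odd_orthogonal N; G = special_isometry_group F in
     {(C, u, e). C \<in> semisimple_classes G G \<and> (let s = elt C in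
        parts_ok s (unip_parts u) \<and>
        unip_one u \<in> odd_symbols (eig_mult s 1 div 2) \<and>
        unip_minus u \<in> even_symbols (eig_type F s (- 1)) (eig_mult s (- 1) div 2) \<and>
        sign_ok (unip_minus u) e)})"

text \<open>Data \<open>(s), u\<close> for \<open>SO\<^sub>2\<^sub>m\<^sub>+\<^sub>1\<close>.\<close>

definition so_labels :: "nat \<Rightarrow> ('f::{field,finite}, 'f alg_closure) so_label set" where
  "so_labels m = (let G = isometry_group (std_symplectic m) in
     {(C, u). C \<in> semisimple_classes G G \<and> (let s = elt C in
        parts_ok s (unip_parts u) \<and>
        unip_one u \<in> odd_symbols (eig_mult s 1 div 2) \<and>
        unip_minus u \<in> odd_symbols (eig_mult s (- 1) div 2))})"

text \<open>Data \<open>(s), u\<close> and extension signs at \<open>1\<close> and \<open>-1\<close> for the orthogonal group of an even-dimensional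
  form.\<close>

definition o_labels :: "'f mat \<Rightarrow> ('f::{field,finite}, 'f alg_closure) o_label set" where
  "o_labels B = {(C, u, \<alpha>, \<beta>).
     C \<in> semisimple_classes (isometry_group B) (special_isometry_group B) \<and> (let s = elt C in
       parts_ok s (unip_parts u) \<and>
       unip_one u \<in> even_symbols (eig_type B s 1) (eig_mult s 1 div 2) \<and>
       unip_minus u \<in> even_symbols (eig_type B s (- 1)) (eig_mult s (- 1) div 2) \<and>
       sign_ok (unip_one u) \<alpha> \<and> sign_ok (unip_minus u) \<beta>)}"

text \<open>The choices on which the correspondences depend: the parametrizations \<open>r\<close> of irreducible
  representations by classification data and the sign \<open>\<epsilon>\<close>, for a symplectic form \<open>J\<close> and a symmetric
  form \<open>B\<close>.  Lusztig's construction is not available, so an arbitrary bijection takes its place.  The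
  parametrizations are total functions; their values outside the set of data are immaterial, and it is
  merely convenient to have them irreducible.\<close>

record ('f, 'x) classification =
  sp_rep :: "('f, 'x) sp_label \<Rightarrow> 'f mat rep set"
  so_rep :: "('f, 'x) so_label \<Rightarrow> 'f mat rep set"
  o_rep :: "('f, 'x) o_label \<Rightarrow> 'f mat rep set"
  eps_sp :: "'f mat set \<Rightarrow> int"
  eps_so :: "'f mat set \<Rightarrow> int"

definition parametrizes :: "('l \<Rightarrow> 'g rep set) \<Rightarrow> 'l set \<Rightarrow> ('g, 'b) monoid_scheme \<Rightarrow> bool" where
  "parametrizes r L G \<longleftrightarrow> bij_betw r L (Irr G) \<and> range r \<subseteq> Irr G"

definition is_classification ::
  "'f::{field,finite} mat \<Rightarrow> 'f mat \<Rightarrow> ('f, 'f alg_closure) classification \<Rightarrow> bool"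
where
  "is_classification J B P \<longleftrightarrow> (let N = dim_row J div 2; m = dim_row B div 2 in
     parametrizes (sp_rep P) (sp_labels N) (isometry_group J) \<and>
     (odd (dim_row B) \<longrightarrow>
        parametrizes (so_rep P) (so_labels m) (special_isometry_group B) \<and>
        (\<forall>C \<in> semisimple_classes (isometry_group (std_symplectic m)) (isometry_group (std_symplectic m)).
           torus_sign (std_symplectic m) (elt C) (eps_sp P C)) \<and>
        (\<forall>C \<in> semisimple_classes (special_isometry_group (std_odd_orthogonal N))
                (special_isometry_group (std_odd_orthogonal N)).
           torus_sign (std_odd_orthogonal N) (elt C) (eps_so P C))) \<and>
     (even (dim_row B) \<longrightarrow> parametrizes (o_rep P) (o_labels B) (isometry_group B)))"

text \<open>For odd-dimensional \<open>B\<close> the orthogonal group is \<open>\<mu>\<^sub>2 \<times> SO\<close>: the element \<open>-1\<close> acts by the sign \<open>\<delta>\<close>.\<close>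

definition sign_extension :: "int \<Rightarrow> 'f::field mat rep \<Rightarrow> 'f mat rep" where
  "sign_extension \<delta> R =
     (fst R, \<lambda>g. if det g = 1 then snd R g else of_int \<delta> \<cdot>\<^sub>m snd R (- g))"

definition odd_o_rep ::
  "'f mat \<Rightarrow> ('f::{field,finite}, 'x) classification \<Rightarrow> int \<times> ('f, 'x) so_label \<Rightarrow> 'f mat rep set"
where
  "odd_o_rep B P = (\<lambda>(\<delta>, x). iso_class (isometry_group B)
     (sign_extension \<delta> (SOME R. R \<in> so_rep P x)))"

section \<open>Eta and zeta correspondences\<close>

text \<open>A recipe \<open>(k, A, B, f)\<close> consists of the new coordinate \<open>k\<close>, the row \<open>A\<close> to which it is to be
  appended, the other row \<open>B\<close>, and the representation \<open>f S\<close> constructed from the altered symbol \<open>S\<close>.\<close>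

type_synonym 'g recipe = "nat \<times> nat list \<times> nat list \<times> (symbol \<Rightarrow> 'g rep set)"

definition constructible :: "nat \<Rightarrow> nat list \<Rightarrow> bool" where
  "constructible k A \<longleftrightarrow> (\<forall>x \<in> set A. x < k)"

fun run_recipe :: "'g recipe \<Rightarrow> 'g virtual_rep" where
  "run_recipe (k, A, B, f) =
     (if constructible k A then frag_of (f (Upair (A @ [k]) B)) else 0)"

text \<open>With \<open>A = [\<lambda>\<^sub>1, \<dots>, \<lambda>\<^sub>a]\<close>, the list \<open>dropWhile (\<lambda>x. x < k) A\<close> is \<open>[\<lambda>\<^sub>i, \<dots>, \<lambda>\<^sub>a]\<close>, of length \<open>a - i + 1\<close>.\<close>

fun run_virtual_recipe :: "'g recipe \<Rightarrow> 'g virtual_rep" where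
  "run_virtual_recipe (k, A, B, f) =
     (if constructible k A then run_recipe (k, A, B, f)
      else if hd (dropWhile (\<lambda>x. x < k) A) = k then 0
      else frag_cmul ((- 1) ^ length (dropWhile (\<lambda>x. x < k) A))
             (frag_of (f (Upair (takeWhile (\<lambda>x. x < k) A @ [k] @ dropWhile (\<lambda>x. x < k) A) B))))"

definition class_with :: "'a set set \<Rightarrow> ('a \<Rightarrow> bool) \<Rightarrow> 'a set" where
  "class_with \<C> Q = (THE C. C \<in> \<C> \<and> (\<forall>t \<in> C. Q t))"

text \<open>Semisimple classes with prescribed eigenvalues: a class is determined by the characteristic
  polynomial and, in the orthogonal groups, the type of the \<open>-1\<close>-eigenspace.\<close>

definition so_class :: "nat \<Rightarrow> 'f::field poly \<Rightarrow> int \<Rightarrow> 'f mat set" where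
  "so_class N p \<tau> = (let F = std_odd_orthogonal N; G = special_isometry_group F in
     class_with (semisimple_classes G G) (\<lambda>t. char_poly t = p \<and> eig_type F t (- 1) = \<tau>))"

definition sp_class :: "nat \<Rightarrow> 'f::field poly \<Rightarrow> 'f mat set" where
  "sp_class m p = (let G = isometry_group (std_symplectic m) in
     class_with (semisimple_classes G G) (\<lambda>t. char_poly t = p))"

definition o_class :: "'f::field mat \<Rightarrow> 'f poly \<Rightarrow> int \<Rightarrow> 'f mat set" where
  "o_class B p \<tau> =
     class_with (semisimple_classes (isometry_group B) (special_isometry_group B))
       (\<lambda>t. char_poly t = p \<and> eig_type B t (- 1) = \<tau>)"

text \<open>\<open>[:- 1, 1:]\<close> and \<open>[:1, 1:]\<close> are \<open>X - 1\<close> and \<open>X + 1\<close>.\<close>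

definition eta_recipe_odd ::
  "'f mat \<Rightarrow> 'f mat \<Rightarrow> ('f::{field,finite}, 'f alg_closure) classification \<Rightarrow> 'f mat rep set
     \<Rightarrow> 'f mat recipe"
where
  "eta_recipe_odd J B P \<pi> = (let
     N = dim_row J div 2; m = dim_row B div 2;
     (\<delta>, C, u) = the_inv_into ({1, - 1} \<times> so_labels m) (odd_o_rep B P) \<pi>;
     (lam, mu) = odd_rows (unip_minus u);
     N' = N - m + (length lam + length mu - 1) div 2;
     D = so_class N (char_poly (elt C) * [:1, 1:] ^ (2 * (N - m)) * [:- 1, 1:]) \<delta>;
     f = (\<lambda>S. sp_rep P (D, with_minus u S, sign_if_nondegenerate S (eps_sp P C * disc B)))
     in if \<delta> = 1 then (N', mu, lam, f) else (N', lam, mu, f))"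

text \<open>The trivial representation of \<open>Sp\<^sub>2\<^sub>r\<close> or \<open>SO\<^sub>2\<^sub>r\<^sub>+\<^sub>1\<close> has the symbol with rows \<open>[r]\<close> and \<open>[]\<close>.\<close>

definition eta_recipe_even ::
  "'f mat \<Rightarrow> 'f mat \<Rightarrow> ('f::{field,finite}, 'f alg_closure) classification \<Rightarrow> 'f mat rep set
     \<Rightarrow> 'f mat recipe"
where
  "eta_recipe_even J B P \<pi> = (let
     N = dim_row J div 2; m = dim_row B div 2;
     (C, u, \<alpha>, \<beta>) = the_inv_into (o_labels B) (o_rep P) \<pi>;
     s = elt C;
     D = so_class N (char_poly s * [:- 1, 1:] ^ (2 * (N - m) + 1)) (eig_type B s (- 1));
     f = (\<lambda>S. sp_rep P (D, with_one u S, \<beta>));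
     (lam, mu) = even_rows (unip_one u);
     N' = N - m + (length lam + length mu) div 2
     in if eig_mult s 1 = 0 then (N - m, [], [], f)
        else if \<alpha> = Some (- 1) then (N', lam, mu, f) else (N', mu, lam, f))"

definition zeta_recipe_odd ::
  "'f mat \<Rightarrow> 'f mat \<Rightarrow> ('f::{field,finite}, 'f alg_closure) classification \<Rightarrow> 'f mat rep set
     \<Rightarrow> 'f mat recipe"
where
  "zeta_recipe_odd J B P \<rho> = (let
     N = dim_row J div 2; m = dim_row B div 2;
     (C, u, e) = the_inv_into (sp_labels N) (sp_rep P) \<rho>;
     s = elt C;
     D = sp_class m (char_poly s div [:- 1, 1:] * [:1, 1:] ^ (2 * (m - N)));
     f = (\<lambda>S. odd_o_rep B P (eps_so P C * disc B, D, with_minus u S));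
     (lam, mu) = even_rows (unip_minus u);
     N' = m - N + (length lam + length mu) div 2
     in if eig_mult s (- 1) = 0 then (m - N, [], [], f)
        else if e = Some (- 1) then (N', mu, lam, f) else (N', lam, mu, f))"

text \<open>Comparing \<open>mu\<close> with \<open>tl lam\<close> compares \<open>\<mu>\<^sub>i\<close> with \<open>\<lambda>\<^sub>i\<^sub>+\<^sub>1\<close>.\<close>

definition alpha_sign :: "int \<Rightarrow> nat \<Rightarrow> nat list \<Rightarrow> nat list \<Rightarrow> int" where
  "alpha_sign \<sigma> N' lam mu =
     (if \<sigma> = 1 \<and> length lam = length mu + 1 \<and> N' \<le> last lam \<and> last_difference_greater mu (tl lam)
      then - 1 else 1)"

definition zeta_recipe_even ::
  "'f mat \<Rightarrow> 'f mat \<Rightarrow> ('f::{field,finite}, 'f alg_closure) classification \<Rightarrow> 'f mat rep set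
     \<Rightarrow> 'f mat recipe"
where
  "zeta_recipe_even J B P \<rho> = (let
     N = dim_row J div 2; m = dim_row B div 2;
     (C, u, e) = the_inv_into (sp_labels N) (sp_rep P) \<rho>;
     s = elt C;
     D = o_class B (char_poly s div [:- 1, 1:] * [:- 1, 1:] ^ (2 * (m - N)))
           (eig_type (std_odd_orthogonal N) s (- 1));
     \<sigma> = eig_type B (elt D) 1;
     (lam, mu) = odd_rows (unip_one u);
     N' = m - N + (length lam + length mu - 1) div 2;
     f = (\<lambda>S. o_rep P (D, with_one u S, sign_if_nondegenerate S (alpha_sign \<sigma> N' lam mu), e))
     in if \<sigma> = 1 then (N', mu, lam, f) else (N', lam, mu, f))"

definition eta_recipe where
  "eta_recipe J B = (if odd (dim_row B) then eta_recipe_odd J B else eta_recipe_even J B)"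

definition zeta_recipe where
  "zeta_recipe J B = (if odd (dim_row B) then zeta_recipe_odd J B else zeta_recipe_even J B)"

definition eta where "eta J B P \<pi> = run_recipe (eta_recipe J B P \<pi>)"

definition zeta where "zeta J B P \<rho> = run_recipe (zeta_recipe J B P \<rho>)"

definition virtual_eta where "virtual_eta J B P \<pi> = run_virtual_recipe (eta_recipe J B P \<pi>)"

definition virtual_zeta where "virtual_zeta J B P \<rho> = run_virtual_recipe (zeta_recipe J B P \<rho>)"

definition omega_top ::
  "'f mat \<Rightarrow> 'f mat \<Rightarrow> ('f::{field,finite}, 'f alg_closure) classification
     \<Rightarrow> ('f mat \<times> 'f mat) virtual_rep"
where
  "omega_top J B P = (\<Sum>\<pi> \<in> Irr (isometry_group B).
     virtual_tensor (isometry_group J) (isometry_group B) (virtual_eta J B P \<pi>) (frag_of \<pi>))"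

definition omega_top' ::
  "'f mat \<Rightarrow> 'f mat \<Rightarrow> ('f::{field,finite}, 'f alg_closure) classification
     \<Rightarrow> ('f mat \<times> 'f mat) virtual_rep"
where
  "omega_top' J B P = (\<Sum>\<rho> \<in> Irr (isometry_group J).
     virtual_tensor (isometry_group J) (isometry_group B) (frag_of \<rho>) (virtual_zeta J B P \<rho>))"

section \<open>Metastable ranges\<close>

text \<open>Here \<open>dim V = 2N\<close> and \<open>dim W = n\<close>, with \<open>n = 2m + 1\<close> or \<open>n = 2m\<close>.\<close>

definition symplectic_metastable :: "nat \<Rightarrow> nat \<Rightarrow> bool" where
  "symplectic_metastable N n \<longleftrightarrow> (let m = n div 2 in
     if odd n then m < N \<and> N < 2 * m + 1 else m \<le> N \<and> N < 2 * m)"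

definition orthogonal_metastable :: "nat \<Rightarrow> nat \<Rightarrow> 'f::field mat \<Rightarrow> bool" where
  "orthogonal_metastable N n B \<longleftrightarrow> (let m = n div 2 in
     if odd n then m < 2 * N \<and> 2 * N \<le> 2 * m
     else if completely_split m B then m < 2 * N \<and> 2 * N < 2 * m
     else int m - 1 < 2 * int N \<and> 2 * N < 2 * m)"

end

theory Submission
  imports Defs "HOL-Computational_Algebra.Fundamental_Theorem_Algebra"
begin

text \<open>
  Each virtual top part is by definition a sum of tensor
  products indexed by the irreducible representations of one factor. The coefficient of such an
  irreducible representation is recovered by taking the Hermitian inner product of characters over
  that factor. With \<open>V\<close> the virtual eta correspondence and \<open>g\<close> fixed, the right-hand side is
  \<open>\<Sum>\<pi>'. \<chi>(V \<pi>') g \<cdot> \<langle>\<chi>(\<pi>'), \<chi>(\<pi>)\<rangle> = \<chi>(V \<pi>) g\<close>, and if \<open>\<eta>(\<pi>)\<close> is non-zero, its datum is constructible and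
  the virtual correspondence takes the same value \<open>\<eta>(\<pi>)\<close>. The argument for zeta is the same with the
  two groups exchanged.

  What carries the proof is therefore the first orthogonality relation for irreducible characters of
  a finite group (\<open>irreducible_character_orthogonality\<close>), established for matrix representations: Schur's
  lemma is applied to averages of matrix units, and invariant Hermitian forms identify the conjugate
  of a character with its value at the inverse. It also shows that there are only finitely many
  irreducible classes (\<open>finite_Irr\<close>). Isometry groups of non-degenerate forms over a finite field are
  finite groups, to which this applies.

  The remaining ingredient is that characters of virtual tensor products are products of characters
  (\<open>virtual_char_virtual_tensor\<close>). This requires that the classes occurring in the correspondences
  are classes of actual representations (\<open>eta_recipe_range\<close>, \<open>zeta_recipe_range\<close>).
\<close>

section \<open>Matrices and traces\<close>

lemma mat_mult_entry:
  assumes "A \<in> carrier_mat n k" "B \<in> carrier_mat k l" "i < n" "j < l"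
  shows "(A * B) $$ (i, j) = (\<Sum>x<k. A $$ (i, x) * B $$ (x, j))"
  using assms by (auto simp: scalar_prod_def atLeast0LessThan intro!: sum.cong)

lemma mat_trace_mult_comm:
  fixes A B :: "'a::comm_semiring_0 mat"
  assumes A: "A \<in> carrier_mat n k" and B: "B \<in> carrier_mat k n"
  shows "mat_trace (A * B) = mat_trace (B * A)"
proof -
  have "mat_trace (A * B) = (\<Sum>i<n. (A * B) $$ (i, i))"
    using A unfolding mat_trace_def by simp
  also have "\<dots> = (\<Sum>i<n. \<Sum>x<k. A $$ (i, x) * B $$ (x, i))"
    by (rule sum.cong[OF refl], rule mat_mult_entry[OF A B]) simp_all
  also have "\<dots> = (\<Sum>x<k. \<Sum>i<n. B $$ (x, i) * A $$ (i, x))"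
    by (subst sum.swap) (simp add: mult.commute)
  also have "\<dots> = (\<Sum>x<k. (B * A) $$ (x, x))"
    by (rule sum.cong[OF refl], rule mat_mult_entry[OF B A, symmetric]) simp_all
  also have "\<dots> = mat_trace (B * A)"
    using B unfolding mat_trace_def by simp
  finally show ?thesis .
qed

lemma invertible_mat_obtain_inverse:
  fixes P :: "'a::semiring_1 mat"
  assumes "P \<in> carrier_mat n n" "invertible_mat P"
  obtains Q where "Q \<in> carrier_mat n n" "P * Q = 1\<^sub>m n" "Q * P = 1\<^sub>m n"
proof -
  obtain Q where Q: "P * Q = 1\<^sub>m (dim_row P)" "Q * P = 1\<^sub>m (dim_row Q)"
    using assms(2) unfolding invertible_mat_def inverts_mat_def by blast
  have "dim_col Q = n" "dim_row Q = n"
    using assms(1) arg_cong[OF Q(1), of dim_col] arg_cong[OF Q(2), of dim_col] by auto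
  then show ?thesis using that[of Q] Q assms(1) by auto
qed

lemma invertible_matI:
  assumes "P \<in> carrier_mat n n" "Q \<in> carrier_mat n n" "P * Q = 1\<^sub>m n" "Q * P = 1\<^sub>m n"
  shows "invertible_mat P"
  using assms unfolding invertible_mat_def inverts_mat_def by auto

lemma det_nonzero_obtain_inverse:
  fixes A :: "'a::field mat"
  assumes A: "A \<in> carrier_mat n n" and "det A \<noteq> 0"
  obtains A' where "A' \<in> carrier_mat n n" "A * A' = 1\<^sub>m n" "A' * A = 1\<^sub>m n"
  using det_non_zero_imp_unit[OF assms, of "()"] unfolding Units_def ring_mat_simps by auto

lemma mat_trace_conjugate:
  fixes A A' :: "'a::comm_semiring_1 mat"
  assumes P: "P \<in> carrier_mat n n" and inv: "invertible_mat P"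
    and A: "A \<in> carrier_mat n n" and A': "A' \<in> carrier_mat n n" and eq: "P * A = A' * P"
  shows "mat_trace A = mat_trace A'"
proof -
  obtain Q where Q: "Q \<in> carrier_mat n n" "P * Q = 1\<^sub>m n" "Q * P = 1\<^sub>m n"
    using invertible_mat_obtain_inverse[OF P inv] .
  have "A' = A' * P * Q" using A' P Q by (simp add: assoc_mult_mat[of _ n n _ n _ n])
  then have "A' = P * (A * Q)" using A P Q eq by (metis assoc_mult_mat)
  then have "mat_trace A' = mat_trace (A * Q * P)"
    using A P Q by (metis mat_trace_mult_comm mult_carrier_mat)
  also have "A * Q * P = A" using A P Q by (simp add: assoc_mult_mat[of _ n n _ n _ n])
  finally show ?thesis ..
qed

lemma mat_trace_one: "mat_trace (1\<^sub>m n :: 'a::semiring_1 mat) = of_nat n"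
  by (simp add: mat_trace_def)

lemma mat_mult_zero_vec:
  fixes A :: "'a::semiring_0 mat"
  shows "A \<in> carrier_mat n k \<Longrightarrow> A *\<^sub>v 0\<^sub>v k = 0\<^sub>v n"
  by (intro eq_vecI) auto

lemma zero_mat_mult_vec:
  fixes v :: "'a::semiring_0 vec"
  shows "v \<in> carrier_vec k \<Longrightarrow> 0\<^sub>m n k *\<^sub>v v = 0\<^sub>v n"
  by (intro eq_vecI) auto

lemma mat_eq_zeroI:
  fixes T :: "'a::semiring_1 mat"
  assumes T: "T \<in> carrier_mat d e" and "\<And>v. v \<in> carrier_vec e \<Longrightarrow> T *\<^sub>v v = 0\<^sub>v d"
  shows "T = 0\<^sub>m d e"
proof (rule eq_matI)
  fix i j assume ij: "i < dim_row (0\<^sub>m d e)" "j < dim_col (0\<^sub>m d e)"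
  have "(T *\<^sub>v unit_vec e j) $ i = 0" using assms(2)[of "unit_vec e j"] ij by simp
  then show "T $$ (i, j) = 0\<^sub>m d e $$ (i, j)" using T ij by simp
qed (use T in auto)

lemma mat_minus_eq_zeroD:
  fixes A B :: "'a::group_add mat"
  assumes "A \<in> carrier_mat n k" "B \<in> carrier_mat n k" "A - B = 0\<^sub>m n k"
  shows "A = B"
proof (rule eq_matI)
  fix i j assume ij: "i < dim_row B" "j < dim_col B"
  then have "A $$ (i, j) - B $$ (i, j) = (A - B) $$ (i, j)" by simp
  also have "\<dots> = 0" unfolding assms(3) using ij assms(2) by simp
  finally show "A $$ (i, j) = B $$ (i, j)" by simp
qed (use assms in auto)

section \<open>Isomorphism classes of representations\<close>

lemma is_repD:
  assumes "is_rep G (d, r)"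
  shows "g \<in> carrier G \<Longrightarrow> r g \<in> carrier_mat d d" "r \<one>\<^bsub>G\<^esub> = 1\<^sub>m d"
    "g \<in> carrier G \<Longrightarrow> h \<in> carrier G \<Longrightarrow> r (g \<otimes>\<^bsub>G\<^esub> h) = r g * r h"
  using assms unfolding is_rep_def by auto

text \<open>Isomorphism of representations is an equivalence relation; hence a class is determined by any of
  its members, and non-isomorphic representations lie in different classes.\<close>

lemma iso_class_refl:
  assumes "is_rep G R"
  shows "R \<in> iso_class G R"
proof -
  obtain d r where R: "R = (d, r)" by (cases R)
  have "invertible_mat (1\<^sub>m d :: complex mat)" by (rule invertible_matI[of _ d "1\<^sub>m d"]) auto
  moreover have "1\<^sub>m d * r g = r g * 1\<^sub>m d" if "g \<in> carrier G" for g
    using is_repD(1)[OF assms[unfolded R] that] by simp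
  ultimately show ?thesis using assms unfolding iso_class_def R
    by (auto intro!: bexI[of _ "1\<^sub>m d"])
qed

lemma iso_class_sym:
  assumes "is_rep G R" "R' \<in> iso_class G R"
  shows "R \<in> iso_class G R'"
proof -
  obtain d r where R: "R = (d, r)" by (cases R)
  obtain s where R': "R' = (d, s)" and rep': "is_rep G R'"
    using assms(2) unfolding iso_class_def R by (cases R') auto
  obtain P where P: "P \<in> carrier_mat d d" "invertible_mat P"
    and eq: "\<And>g. g \<in> carrier G \<Longrightarrow> P * r g = s g * P"
    using assms(2) unfolding iso_class_def R R' by auto
  obtain Q where Q: "Q \<in> carrier_mat d d" "P * Q = 1\<^sub>m d" "Q * P = 1\<^sub>m d"
    using invertible_mat_obtain_inverse[OF P] .
  have "Q * s g = r g * Q" if g: "g \<in> carrier G" for g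
  proof -
    have c: "r g \<in> carrier_mat d d" "s g \<in> carrier_mat d d"
      using is_repD(1)[OF assms(1)[unfolded R] g] is_repD(1)[OF rep'[unfolded R'] g] by simp_all
    have "Q * s g = Q * (s g * P) * Q"
      using c P Q by (simp add: assoc_mult_mat[of _ d d _ d _ d])
    also have "\<dots> = (Q * P) * (r g * Q)"
      unfolding eq[OF g, symmetric] using c P(1) Q(1)
      by (simp add: assoc_mult_mat[of _ d d _ d _ d])
    finally show ?thesis using Q c by simp
  qed
  then show ?thesis using assms(1) Q invertible_matI[OF Q(1) P(1) Q(3,2)]
    unfolding iso_class_def R R' by auto
qed

lemma iso_class_trans:
  assumes "is_rep G R" "R' \<in> iso_class G R" "R'' \<in> iso_class G R'"
  shows "R'' \<in> iso_class G R"
proof -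
  obtain d r where R: "R = (d, r)" by (cases R)
  obtain s where R': "R' = (d, s)" and rep': "is_rep G R'"
    using assms(2) unfolding iso_class_def R by (cases R') auto
  obtain t where R'': "R'' = (d, t)" and rep'': "is_rep G R''"
    using assms(3) unfolding iso_class_def R' by (cases R'') auto
  obtain P where P: "P \<in> carrier_mat d d" "invertible_mat P"
    and eqP: "\<And>g. g \<in> carrier G \<Longrightarrow> P * r g = s g * P"
    using assms(2) unfolding iso_class_def R R' by auto
  obtain P' where P': "P' \<in> carrier_mat d d" "invertible_mat P'"
    and eqP': "\<And>g. g \<in> carrier G \<Longrightarrow> P' * s g = t g * P'"
    using assms(3) unfolding iso_class_def R' R'' by auto
  obtain Q where Q: "Q \<in> carrier_mat d d" "P * Q = 1\<^sub>m d" "Q * P = 1\<^sub>m d"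
    using invertible_mat_obtain_inverse[OF P] .
  obtain Q' where Q': "Q' \<in> carrier_mat d d" "P' * Q' = 1\<^sub>m d" "Q' * P' = 1\<^sub>m d"
    using invertible_mat_obtain_inverse[OF P'] .
  have "P' * P * (Q * Q') = P' * (P * Q) * Q'" "Q * Q' * (P' * P) = Q * (Q' * P') * P"
    using P(1) P'(1) Q(1) Q'(1) by (simp_all add: assoc_mult_mat[of _ d d _ d _ d])
  then have "P' * P * (Q * Q') = 1\<^sub>m d" "Q * Q' * (P' * P) = 1\<^sub>m d"
    using P(1) P'(1) Q Q' by simp_all
  then have "invertible_mat (P' * P)"
    using P(1) P'(1) Q(1) Q'(1) by (intro invertible_matI[of _ d "Q * Q'"]) auto
  moreover have "P' * P * r g = t g * (P' * P)" if g: "g \<in> carrier G" for g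
  proof -
    have c: "r g \<in> carrier_mat d d" "s g \<in> carrier_mat d d" "t g \<in> carrier_mat d d"
      using is_repD(1)[OF assms(1)[unfolded R] g] is_repD(1)[OF rep'[unfolded R'] g]
        is_repD(1)[OF rep''[unfolded R''] g] by simp_all
    have "P' * P * r g = P' * (s g * P)"
      unfolding eqP[OF g, symmetric] using c P(1) P'(1)
      by (simp add: assoc_mult_mat[of _ d d _ d _ d])
    also have "\<dots> = (P' * s g) * P"
      using c P(1) P'(1) by (simp add: assoc_mult_mat[of _ d d _ d _ d])
    finally show ?thesis unfolding eqP'[OF g]
      using c P(1) P'(1) by (simp add: assoc_mult_mat[of _ d d _ d _ d])
  qed
  ultimately show ?thesis using rep'' P(1) P'(1) unfolding iso_class_def R R''
    by (auto intro!: bexI[of _ "P' * P"])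
qed

lemma iso_class_eqI:
  assumes "is_rep G R" "R' \<in> iso_class G R"
  shows "iso_class G R' = iso_class G R"
proof -
  have "is_rep G R'" using assms(2) unfolding iso_class_def by auto
  then show ?thesis
    using iso_class_trans[OF assms] iso_class_sym[OF assms] iso_class_trans by blast
qed

text \<open>The classes of arbitrary, possibly reducible representations: a setting in which the characters of
  tensor products can be computed, and which contains the extensions of representations from \<open>SO\<close> to \<open>O\<close>
  occurring in the zeta correspondence.\<close>

definition rep_classes :: "('g, 'b) monoid_scheme \<Rightarrow> 'g rep set set" where
  "rep_classes G = {iso_class G R | R. is_rep G R}"

lemma rep_classesI: "is_rep G R \<Longrightarrow> iso_class G R \<in> rep_classes G"
  unfolding rep_classes_def by blast

lemma Irr_subset_rep_classes: "Irr G \<subseteq> rep_classes G"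
  unfolding Irr_def rep_classes_def irreducible_rep_def by auto

text \<open>Characters and tensor products of classes are defined through a chosen member. Classes
  are non-empty by reflexivity, so the choice is sound, and it does not affect the character because
  the trace is invariant under conjugation.\<close>

lemma is_rep_some_member:
  assumes "c \<in> rep_classes G"
  shows "is_rep G (SOME R. R \<in> c)"
proof -
  obtain R where "is_rep G R" "c = iso_class G R" using assms unfolding rep_classes_def by auto
  then have "(SOME R. R \<in> c) \<in> iso_class G R" using iso_class_refl[of G R] someI[of "\<lambda>R. R \<in> c"] by auto
  then show ?thesis unfolding iso_class_def by auto
qed

lemma class_char_iso_class:
  assumes "is_rep G R" "g \<in> carrier G"
  shows "class_char (iso_class G R) g = mat_trace (snd R g)"
proof -
  define S where "S = (SOME S. S \<in> iso_class G R)"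
  have S: "S \<in> iso_class G R"
    unfolding S_def using iso_class_refl[OF assms(1)] by (rule someI)
  obtain d r where R: "R = (d, r)" by (cases R)
  obtain s where S': "S = (d, s)" and rep': "is_rep G S"
    using S unfolding iso_class_def R by (cases S) auto
  obtain P where P: "P \<in> carrier_mat d d" "invertible_mat P" "P * r g = s g * P"
    using S assms(2) unfolding iso_class_def R S' by auto
  have "mat_trace (r g) = mat_trace (s g)"
    using mat_trace_conjugate[OF P(1,2) _ _ P(3)] is_repD(1)[OF assms(1)[unfolded R] assms(2)]
      is_repD(1)[OF rep'[unfolded S'] assms(2)] by simp
  then show ?thesis unfolding class_char_def S_def[symmetric] by (simp add: R S')
qed

section \<open>Schur's lemma\<close>

text \<open>The kernel of an intertwiner is an invariant subspace of the source and its image one of the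
  target, so by irreducibility a non-zero intertwiner has trivial kernel and full image. Preimages of
  the standard basis vectors are the columns of a right inverse, which injectivity makes two-sided.\<close>

lemma schur_intertwiner_invertible:
  fixes T :: "complex mat"
  assumes irr: "irreducible_rep G (d, r)" "irreducible_rep G (e, s)"
    and T: "T \<in> carrier_mat d e" and eq: "\<And>g. g \<in> carrier G \<Longrightarrow> r g * T = T * s g"
    and nz: "T \<noteq> 0\<^sub>m d e"
  obtains Y where "Y \<in> carrier_mat e d" "T * Y = 1\<^sub>m d" "Y * T = 1\<^sub>m e"
proof -
  have rep: "is_rep G (d, r)" "is_rep G (e, s)" using irr unfolding irreducible_rep_def by auto
  note r = is_repD(1)[OF rep(1)] and s = is_repD(1)[OF rep(2)]
  have move: "r g *\<^sub>v (T *\<^sub>v v) = T *\<^sub>v (s g *\<^sub>v v)" if "g \<in> carrier G" "v \<in> carrier_vec e" for g v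
    using r[OF that(1)] s[OF that(1)] T that eq[OF that(1)]
    by (metis assoc_mult_mat_vec)
  let ?K = "{v \<in> carrier_vec e. T *\<^sub>v v = 0\<^sub>v d}"
  have "invariant_subspace G (e, s) ?K"
    unfolding invariant_subspace_def prod.case
  proof (intro conjI ballI allI)
    show "?K \<subseteq> carrier_vec e" by auto
    show "0\<^sub>v e \<in> ?K" using T by auto
    show "u + v \<in> ?K" if "u \<in> ?K" "v \<in> ?K" for u v
      using that by (auto simp: mult_add_distrib_mat_vec[OF T])
    show "c \<cdot>\<^sub>v u \<in> ?K" if "u \<in> ?K" for c u
      using that by (auto simp: mult_mat_vec[OF T])
    show "s g *\<^sub>v u \<in> ?K" if g: "g \<in> carrier G" and "u \<in> ?K" for g u
    proof -
      have "u \<in> carrier_vec e" "T *\<^sub>v u = 0\<^sub>v d" using \<open>u \<in> ?K\<close> by auto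
      moreover have "r g *\<^sub>v 0\<^sub>v d = 0\<^sub>v d" using r[OF g] by (rule mat_mult_zero_vec)
      ultimately have "T *\<^sub>v (s g *\<^sub>v u) = 0\<^sub>v d" using move[OF g, of u] by simp
      then show ?thesis using s[OF g] \<open>u \<in> carrier_vec e\<close> by auto
    qed
  qed
  moreover have "?K \<noteq> carrier_vec e" using mat_eq_zeroI[OF T] nz by blast
  ultimately have K: "?K = {0\<^sub>v e}" using irr(2) unfolding irreducible_rep_def by auto
  let ?I = "{T *\<^sub>v v | v. v \<in> carrier_vec e}"
  have "invariant_subspace G (d, r) ?I"
    unfolding invariant_subspace_def prod.case
  proof (intro conjI ballI allI)
    show "?I \<subseteq> carrier_vec d" using T by auto
    show "0\<^sub>v d \<in> ?I" using T by (auto intro!: exI[of _ "0\<^sub>v e"])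
    show "u + v \<in> ?I" if "u \<in> ?I" "v \<in> ?I" for u v
      using that by (auto simp flip: mult_add_distrib_mat_vec[OF T])
    show "c \<cdot>\<^sub>v u \<in> ?I" if "u \<in> ?I" for c u
      using that by (auto simp flip: mult_mat_vec[OF T])
    show "r g *\<^sub>v u \<in> ?I" if g: "g \<in> carrier G" and "u \<in> ?I" for g u
    proof -
      obtain v where v: "u = T *\<^sub>v v" "v \<in> carrier_vec e" using \<open>u \<in> ?I\<close> by auto
      show ?thesis using move[OF g v(2)] s[OF g] v by auto
    qed
  qed
  moreover have "?I \<noteq> {0\<^sub>v d}" using mat_eq_zeroI[OF T] nz by blast
  ultimately have I: "?I = carrier_vec d" using irr(1) unfolding irreducible_rep_def by auto
  have "\<exists>x. x \<in> carrier_vec e \<and> T *\<^sub>v x = unit_vec d j" for j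
  proof -
    have "unit_vec d j \<in> ?I" unfolding I by simp
    then show ?thesis by force
  qed
  then obtain x where x: "\<And>j. x j \<in> carrier_vec e" "\<And>j. T *\<^sub>v x j = unit_vec d j" by metis
  define Y where "Y = mat e d (\<lambda>(i, j). x j $ i)"
  have Y: "Y \<in> carrier_mat e d" unfolding Y_def by simp
  have TY: "T * Y = 1\<^sub>m d"
  proof (rule eq_matI)
    fix i j assume ij: "i < dim_row (1\<^sub>m d)" "j < dim_col (1\<^sub>m d)"
    have "col Y j = x j" using ij x(1)[of j] unfolding Y_def by (auto intro!: eq_vecI)
    then have "(T * Y) $$ (i, j) = (T *\<^sub>v x j) $ i" using T Y ij by simp
    then show "(T * Y) $$ (i, j) = 1\<^sub>m d $$ (i, j)" using x(2)[of j] ij by simp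
  qed (use T Y in auto)
  define D where "D = Y * T - 1\<^sub>m e"
  have D: "D \<in> carrier_mat e e" unfolding D_def by (rule minus_carrier_mat) simp
  have "T * (Y * T) = T" using assoc_mult_mat[OF T Y T] TY T by simp
  then have TD: "T * D = 0\<^sub>m d e" unfolding D_def
    using T Y by (subst mult_minus_distrib_mat[of _ d e _ e]) auto
  have "D *\<^sub>v v \<in> ?K" if "v \<in> carrier_vec e" for v
    using assoc_mult_mat_vec[OF T D that] zero_mat_mult_vec[OF that, of d] TD that D by auto
  then have "D = 0\<^sub>m e e" using mat_eq_zeroI[OF D] K by blast
  then have "Y * T = 1\<^sub>m e"
    using mat_minus_eq_zeroD[of "Y * T" e e "1\<^sub>m e"] Y T unfolding D_def by auto
  then show ?thesis using that Y TY by blast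
qed

text \<open>Subtracting an eigenvalue makes the intertwiner singular, hence zero by the
  preceding lemma.\<close>

lemma schur_intertwiner_scalar:
  fixes T :: "complex mat"
  assumes irr: "irreducible_rep G (d, r)"
    and T: "T \<in> carrier_mat d d" and eq: "\<And>g. g \<in> carrier G \<Longrightarrow> r g * T = T * r g"
  obtains c where "T = c \<cdot>\<^sub>m 1\<^sub>m d"
proof -
  have rep: "is_rep G (d, r)" and d: "0 < d" using irr unfolding irreducible_rep_def by auto
  obtain c where "poly (char_poly T) c = 0"
    using alg_closed_imp_poly_has_root[of "char_poly T"] degree_monic_char_poly[OF T] d by auto
  then obtain v where v: "v \<in> carrier_vec d" "v \<noteq> 0\<^sub>v d" "T *\<^sub>v v = c \<cdot>\<^sub>v v"
    using eigenvalue_root_char_poly[OF T] T unfolding eigenvalue_def eigenvector_def by auto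
  define S where "S = T - c \<cdot>\<^sub>m 1\<^sub>m d"
  have S: "S \<in> carrier_mat d d" unfolding S_def by (rule minus_carrier_mat) simp
  have Seq: "r g * S = S * r g" if "g \<in> carrier G" for g
    using is_repD(1)[OF rep that] T eq[OF that] unfolding S_def
    by (simp add: mult_minus_distrib_mat[of _ d d _ d] minus_mult_distrib_mat[of _ d d _ _ d]
        mult_smult_distrib[of _ d d _ d] mult_smult_assoc_mat[of _ d d _ d])
  have "(c \<cdot>\<^sub>m 1\<^sub>m d) *\<^sub>v v = c \<cdot>\<^sub>v v"
    using v(1) by (intro eq_vecI) (auto simp: row_smult)
  then have Sv: "S *\<^sub>v v = 0\<^sub>v d" unfolding S_def
    using T v by (simp add: minus_mult_distrib_mat_vec[of _ d d])
  have "S = 0\<^sub>m d d"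
  proof (rule ccontr)
    assume "S \<noteq> 0\<^sub>m d d"
    then obtain Y where Y: "Y \<in> carrier_mat d d" "Y * S = 1\<^sub>m d"
      using schur_intertwiner_invertible[OF irr irr S Seq] by blast
    have "v = Y *\<^sub>v (S *\<^sub>v v)" using assoc_mult_mat_vec[OF Y(1) S v(1)] Y(2) v(1) by simp
    then show False using Sv v(2) mat_mult_zero_vec[OF Y(1)] by simp
  qed
  then have "T = c \<cdot>\<^sub>m 1\<^sub>m d"
    using mat_minus_eq_zeroD[of T d d "c \<cdot>\<^sub>m 1\<^sub>m d"] T unfolding S_def by auto
  then show ?thesis using that by blast
qed

section \<open>Orthogonality of irreducible characters\<close>

lemma sum_left_translate:
  assumes "group G" "h \<in> carrier G"
  shows "(\<Sum>g\<in>carrier G. f (h \<otimes>\<^bsub>G\<^esub> g)) = (\<Sum>g\<in>carrier G. f g)"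
proof -
  interpret group G by fact
  show ?thesis using assms(2)
    by (intro sum.reindex_bij_witness[of _ "\<lambda>g. inv\<^bsub>G\<^esub> h \<otimes>\<^bsub>G\<^esub> g" "\<lambda>g. h \<otimes>\<^bsub>G\<^esub> g"])
      (simp_all flip: m_assoc)
qed

lemma sum_right_translate:
  assumes "group G" "h \<in> carrier G"
  shows "(\<Sum>g\<in>carrier G. f (g \<otimes>\<^bsub>G\<^esub> h)) = (\<Sum>g\<in>carrier G. f g)"
proof -
  interpret group G by fact
  show ?thesis using assms(2)
    by (intro sum.reindex_bij_witness[of _ "\<lambda>g. g \<otimes>\<^bsub>G\<^esub> inv\<^bsub>G\<^esub> h" "\<lambda>g. g \<otimes>\<^bsub>G\<^esub> h"])
      (simp_all add: m_assoc)
qed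

lemma rep_entry_mult:
  assumes "is_rep G (d, r)" "g \<in> carrier G" "h \<in> carrier G" "i < d" "j < d"
  shows "r (g \<otimes>\<^bsub>G\<^esub> h) $$ (i, j) = (\<Sum>k<d. r g $$ (i, k) * r h $$ (k, j))"
  unfolding is_repD(3)[OF assms(1-3)]
  by (rule mat_mult_entry[OF is_repD(1)[OF assms(1,2)] is_repD(1)[OF assms(1,3)] assms(4,5)])

text \<open>Averaging the matrix unit with entry \<open>1\<close> at \<open>(a, b)\<close> over the group, that is the matrix
  \<open>\<Sum>g. r g E s g\<inverse>\<close>, produces an intertwiner from \<open>S\<close> to \<open>R\<close>. Matrices of varying size do not form a
  monoid type, so the sum is taken entry by entry.\<close>

definition averaged_unit ::
  "('g, 'b) monoid_scheme \<Rightarrow> 'g rep \<Rightarrow> 'g rep \<Rightarrow> nat \<Rightarrow> nat \<Rightarrow> complex mat"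
where
  "averaged_unit G R S a b = mat (fst R) (fst S)
     (\<lambda>(i, j). \<Sum>g\<in>carrier G. snd R g $$ (i, a) * snd S (inv\<^bsub>G\<^esub> g) $$ (b, j))"

lemma averaged_unit_entry:
  "i < d \<Longrightarrow> j < e \<Longrightarrow> averaged_unit G (d, r) (e, s) a b $$ (i, j) =
    (\<Sum>g\<in>carrier G. r g $$ (i, a) * s (inv\<^bsub>G\<^esub> g) $$ (b, j))"
  unfolding averaged_unit_def by simp

lemma averaged_unit_carrier: "averaged_unit G (d, r) (e, s) a b \<in> carrier_mat d e"
  unfolding averaged_unit_def by simp

text \<open>Multiplication by \<open>r h\<close> on the left permutes the summands, and so does multiplication by \<open>s h\<close>
  on the right, with the same effect.\<close>

lemma averaged_unit_intertwines:
  assumes "group G" and r: "is_rep G (d, r)" and s: "is_rep G (e, s)"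
    and h: "h \<in> carrier G" and ab: "a < d" "b < e"
  shows "r h * averaged_unit G (d, r) (e, s) a b = averaged_unit G (d, r) (e, s) a b * s h"
    (is "_ * ?T = _")
proof (rule eq_matI)
  interpret group G by fact
  note T = averaged_unit_carrier[of G d r e s a b]
  note rh = is_repD(1)[OF r h] and sh = is_repD(1)[OF s h]
  fix i j assume "i < dim_row (?T * s h)" "j < dim_col (?T * s h)"
  then have ij: "i < d" "j < e" using T sh by auto
  have "(r h * ?T) $$ (i, j) =
      (\<Sum>k<d. r h $$ (i, k) * (\<Sum>g\<in>carrier G. r g $$ (k, a) * s (inv\<^bsub>G\<^esub> g) $$ (b, j)))"
    unfolding mat_mult_entry[OF rh T ij] using ij by (simp add: averaged_unit_entry)
  also have "\<dots> = (\<Sum>g\<in>carrier G. (\<Sum>k<d. r h $$ (i, k) * r g $$ (k, a)) * s (inv\<^bsub>G\<^esub> g) $$ (b, j))"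
    by (simp add: sum_distrib_left sum_distrib_right mult.assoc) (rule sum.swap)
  also have "\<dots> = (\<Sum>g\<in>carrier G. r (h \<otimes>\<^bsub>G\<^esub> g) $$ (i, a) * s (inv\<^bsub>G\<^esub> (h \<otimes>\<^bsub>G\<^esub> g) \<otimes>\<^bsub>G\<^esub> h) $$ (b, j))"
    using h ij ab by (intro sum.cong refl)
      (simp add: rep_entry_mult[OF r] inv_mult_group m_assoc)
  also have "\<dots> = (\<Sum>g\<in>carrier G. r g $$ (i, a) * s (inv\<^bsub>G\<^esub> g \<otimes>\<^bsub>G\<^esub> h) $$ (b, j))"
    by (rule sum_left_translate[OF assms(1) h, where f = "\<lambda>g. r g $$ (i, a) * s (inv\<^bsub>G\<^esub> g \<otimes>\<^bsub>G\<^esub> h) $$ (b, j)"])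
  also have "\<dots> = (\<Sum>k<e. (\<Sum>g\<in>carrier G. r g $$ (i, a) * s (inv\<^bsub>G\<^esub> g) $$ (b, k)) * s h $$ (k, j))"
    using h ij ab
    by (simp add: rep_entry_mult[OF s] sum_distrib_left sum_distrib_right mult.assoc) (rule sum.swap)
  also have "\<dots> = (?T * s h) $$ (i, j)"
    unfolding mat_mult_entry[OF T sh ij] using ij by (simp add: averaged_unit_entry)
  finally show "(r h * ?T) $$ (i, j) = (?T * s h) $$ (i, j)" .
next
  note T = averaged_unit_carrier[of G d r e s a b]
  show "dim_row (r h * ?T) = dim_row (?T * s h)" "dim_col (r h * ?T) = dim_col (?T * s h)"
    using T is_repD(1)[OF r h] is_repD(1)[OF s h] by auto
qed

text \<open>Both traces are expanded along the diagonal; collecting the terms with fixed diagonal positions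
  gives one entry of an averaged matrix unit. Schur's lemma evaluates these entries.\<close>

lemma sum_trace_product:
  assumes "group G" and r: "is_rep G (d, r)" and s: "is_rep G (e, s)"
  shows "(\<Sum>g\<in>carrier G. mat_trace (r g) * mat_trace (s (inv\<^bsub>G\<^esub> g))) =
    (\<Sum>a<d. \<Sum>b<e. averaged_unit G (d, r) (e, s) a b $$ (a, b))"
proof -
  interpret group G by fact
  have "(\<Sum>g\<in>carrier G. mat_trace (r g) * mat_trace (s (inv\<^bsub>G\<^esub> g))) =
      (\<Sum>g\<in>carrier G. \<Sum>a<d. \<Sum>b<e. r g $$ (a, a) * s (inv\<^bsub>G\<^esub> g) $$ (b, b))"
  proof (intro sum.cong refl)
    fix g assume g: "g \<in> carrier G"
    have "dim_row (r g) = d" "dim_row (s (inv\<^bsub>G\<^esub> g)) = e"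
      using is_repD(1)[OF r g] is_repD(1)[OF s inv_closed[OF g]] by auto
    then show "mat_trace (r g) * mat_trace (s (inv\<^bsub>G\<^esub> g)) =
        (\<Sum>a<d. \<Sum>b<e. r g $$ (a, a) * s (inv\<^bsub>G\<^esub> g) $$ (b, b))"
      by (simp add: mat_trace_def sum_product)
  qed
  also have "\<dots> = (\<Sum>a<d. \<Sum>g\<in>carrier G. \<Sum>b<e. r g $$ (a, a) * s (inv\<^bsub>G\<^esub> g) $$ (b, b))"
    by (rule sum.swap)
  also have "\<dots> = (\<Sum>a<d. \<Sum>b<e. \<Sum>g\<in>carrier G. r g $$ (a, a) * s (inv\<^bsub>G\<^esub> g) $$ (b, b))"
    by (intro sum.cong refl sum.swap)
  finally show ?thesis by (simp add: averaged_unit_entry)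
qed

lemma sum_trace_product_nonisomorphic:
  assumes "group G" and irr: "irreducible_rep G (d, r)" "irreducible_rep G (e, s)"
    and neq: "iso_class G (d, r) \<noteq> iso_class G (e, s)"
  shows "(\<Sum>g\<in>carrier G. mat_trace (r g) * mat_trace (s (inv\<^bsub>G\<^esub> g))) = 0"
proof -
  have rep: "is_rep G (d, r)" "is_rep G (e, s)" using irr unfolding irreducible_rep_def by auto
  have "averaged_unit G (d, r) (e, s) a b = 0\<^sub>m d e" if ab: "a < d" "b < e" for a b
  proof (rule ccontr)
    define T where "T = averaged_unit G (d, r) (e, s) a b"
    have T: "T \<in> carrier_mat d e" unfolding T_def by (rule averaged_unit_carrier)
    have tw: "r h * T = T * s h" if "h \<in> carrier G" for h
      unfolding T_def by (rule averaged_unit_intertwines[OF assms(1) rep that ab])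
    assume "averaged_unit G (d, r) (e, s) a b \<noteq> 0\<^sub>m d e"
    then have "T \<noteq> 0\<^sub>m d e" unfolding T_def .
    then obtain Y where Y: "Y \<in> carrier_mat e d" "T * Y = 1\<^sub>m d" "Y * T = 1\<^sub>m e"
      using schur_intertwiner_invertible[OF irr T tw] by blast
    have "(of_nat d :: complex) = of_nat e"
      using mat_trace_mult_comm[OF T Y(1)] unfolding Y(2,3) mat_trace_one .
    then have de: "d = e" by simp
    have "invertible_mat T" using T Y de by (intro invertible_matI[of T e Y]) auto
    then have "(d, r) \<in> iso_class G (e, s)"
      using rep T tw unfolding iso_class_def de by (auto intro!: bexI[of _ T])
    then show False using iso_class_eqI[OF rep(2)] neq by simp
  qed
  then show ?thesis unfolding sum_trace_product[OF assms(1) rep] by simp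
qed

text \<open>An averaged matrix unit is a scalar matrix, and its trace is that of \<open>|G|\<close> times the matrix
  unit itself, because the trace is invariant under conjugation. This determines the scalar.\<close>

lemma sum_trace_product_self:
  assumes "group G" and irr: "irreducible_rep G (d, r)"
  shows "(\<Sum>g\<in>carrier G. mat_trace (r g) * mat_trace (r (inv\<^bsub>G\<^esub> g))) = of_nat (card (carrier G))"
proof -
  interpret group G by fact
  have rep: "is_rep G (d, r)" and d: "0 < d" using irr unfolding irreducible_rep_def by auto
  let ?T = "averaged_unit G (d, r) (d, r)"
  have trace: "(\<Sum>i<d. ?T a b $$ (i, i)) = (if a = b then of_nat (card (carrier G)) else 0)"
    if ab: "a < d" "b < d" for a b
  proof -
    have "(\<Sum>i<d. ?T a b $$ (i, i)) =
        (\<Sum>g\<in>carrier G. \<Sum>i<d. r (inv\<^bsub>G\<^esub> g) $$ (b, i) * r g $$ (i, a))"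
      by (simp add: averaged_unit_entry mult.commute) (rule sum.swap)
    also have "\<dots> = (\<Sum>g\<in>carrier G. r (inv\<^bsub>G\<^esub> g \<otimes>\<^bsub>G\<^esub> g) $$ (b, a))"
      using ab by (intro sum.cong refl) (rule rep_entry_mult[OF rep, symmetric], simp_all)
    also have "\<dots> = (\<Sum>g\<in>carrier G. if a = b then 1 else 0)"
      using ab by (intro sum.cong refl) (simp add: is_repD(2)[OF rep])
    finally show ?thesis by simp
  qed
  have entry: "?T a b $$ (a, b) = (if a = b then of_nat (card (carrier G)) / of_nat d else 0)"
    if ab: "a < d" "b < d" for a b
  proof -
    obtain c where c: "?T a b = c \<cdot>\<^sub>m 1\<^sub>m d"
      using schur_intertwiner_scalar[OF irr averaged_unit_carrier
          averaged_unit_intertwines[OF assms(1) rep rep _ ab]] by blast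
    have "of_nat d * c = (if a = b then of_nat (card (carrier G)) else 0)"
      using trace[OF ab] unfolding c by simp
    then show ?thesis unfolding c using ab d by (auto simp: field_simps)
  qed
  have "(\<Sum>a<d. \<Sum>b<d. ?T a b $$ (a, b)) = (\<Sum>a<d. of_nat (card (carrier G)) / of_nat d)"
    by (intro sum.cong refl) (simp add: entry)
  then show ?thesis unfolding sum_trace_product[OF assms(1) rep rep] using d by simp
qed

text \<open>Weyl's unitary trick: averaging the standard Hermitian form over the group gives an invariant
  form with Gram matrix \<open>H\<close>, and \<open>H\<close> conjugates \<open>r h\<inverse>\<close> to the adjoint of \<open>r h\<close>. The form is positive
  definite because the identity contributes the standard form to the sum of squares, so \<open>H\<close> is
  invertible and the two traces agree.\<close>

lemma trace_inverse:
  assumes "group G" "finite (carrier G)" and rep: "is_rep G (d, r)" and h: "h \<in> carrier G"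
  shows "mat_trace (r (inv\<^bsub>G\<^esub> h)) = cnj (mat_trace (r h))"
proof -
  interpret group G by fact
  define H where "H = mat d d (\<lambda>(i, j). \<Sum>g\<in>carrier G. \<Sum>k<d. cnj (r g $$ (k, i)) * r g $$ (k, j))"
  define A where "A = mat d d (\<lambda>(i, j). cnj (r h $$ (j, i)))"
  have H: "H \<in> carrier_mat d d" and A: "A \<in> carrier_mat d d" unfolding H_def A_def by auto
  have inv: "inv\<^bsub>G\<^esub> h \<in> carrier G" using h by simp
  note rh = is_repD(1)[OF rep h] and rih = is_repD(1)[OF rep inv]
  have entryH: "H $$ (i, j) = (\<Sum>g\<in>carrier G. \<Sum>k<d. cnj (r g $$ (k, i)) * r g $$ (k, j))"
    if "i < d" "j < d" for i j using that unfolding H_def by simp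
  have "A * H = H * r (inv\<^bsub>G\<^esub> h)"
  proof (rule eq_matI)
    fix i j assume "i < dim_row (H * r (inv\<^bsub>G\<^esub> h))" "j < dim_col (H * r (inv\<^bsub>G\<^esub> h))"
    then have ij: "i < d" "j < d" using H rih by auto
    have "(A * H) $$ (i, j) =
        (\<Sum>l<d. \<Sum>g\<in>carrier G. \<Sum>k<d. cnj (r h $$ (l, i)) * (cnj (r g $$ (k, l)) * r g $$ (k, j)))"
      unfolding mat_mult_entry[OF A H ij] using ij by (simp add: A_def entryH sum_distrib_left)
    also have "\<dots> = (\<Sum>g\<in>carrier G. \<Sum>l<d. \<Sum>k<d. cnj (r h $$ (l, i)) * (cnj (r g $$ (k, l)) * r g $$ (k, j)))"
      by (rule sum.swap)
    also have "\<dots> = (\<Sum>g\<in>carrier G. \<Sum>k<d. \<Sum>l<d. cnj (r h $$ (l, i)) * (cnj (r g $$ (k, l)) * r g $$ (k, j)))"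
      by (intro sum.cong refl sum.swap)
    also have "\<dots> = (\<Sum>g\<in>carrier G. \<Sum>k<d. cnj (r (g \<otimes>\<^bsub>G\<^esub> h) $$ (k, i)) * r g $$ (k, j))"
      using h ij by (intro sum.cong refl)
        (simp add: rep_entry_mult[OF rep] sum_distrib_left sum_distrib_right mult_ac)
    also have "\<dots> = (\<Sum>g\<in>carrier G. \<Sum>k<d. cnj (r (g \<otimes>\<^bsub>G\<^esub> h) $$ (k, i)) * r ((g \<otimes>\<^bsub>G\<^esub> h) \<otimes>\<^bsub>G\<^esub> inv\<^bsub>G\<^esub> h) $$ (k, j))"
      using h by (intro sum.cong refl) (simp add: m_assoc)
    also have "\<dots> = (\<Sum>g\<in>carrier G. \<Sum>k<d. cnj (r g $$ (k, i)) * r (g \<otimes>\<^bsub>G\<^esub> inv\<^bsub>G\<^esub> h) $$ (k, j))"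
      by (rule sum_right_translate[OF assms(1) h,
            where f = "\<lambda>g. \<Sum>k<d. cnj (r g $$ (k, i)) * r (g \<otimes>\<^bsub>G\<^esub> inv\<^bsub>G\<^esub> h) $$ (k, j)"])
    also have "\<dots> = (\<Sum>g\<in>carrier G. \<Sum>k<d. \<Sum>l<d. cnj (r g $$ (k, i)) * r g $$ (k, l) * r (inv\<^bsub>G\<^esub> h) $$ (l, j))"
      using inv ij by (intro sum.cong refl)
        (simp add: rep_entry_mult[OF rep] sum_distrib_left mult.assoc)
    also have "\<dots> = (\<Sum>g\<in>carrier G. \<Sum>l<d. \<Sum>k<d. cnj (r g $$ (k, i)) * r g $$ (k, l) * r (inv\<^bsub>G\<^esub> h) $$ (l, j))"
      by (intro sum.cong refl sum.swap)
    also have "\<dots> = (\<Sum>l<d. \<Sum>g\<in>carrier G. \<Sum>k<d. cnj (r g $$ (k, i)) * r g $$ (k, l) * r (inv\<^bsub>G\<^esub> h) $$ (l, j))"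
      by (rule sum.swap)
    also have "\<dots> = (H * r (inv\<^bsub>G\<^esub> h)) $$ (i, j)"
      unfolding mat_mult_entry[OF H rih ij] using ij by (simp add: entryH sum_distrib_right)
    finally show "(A * H) $$ (i, j) = (H * r (inv\<^bsub>G\<^esub> h)) $$ (i, j)" .
  qed (use A H rih in auto)
  moreover have "det H \<noteq> 0"
  proof
    assume "det H = 0"
    then obtain v where v: "v \<in> carrier_vec d" "v \<noteq> 0\<^sub>v d" "H *\<^sub>v v = 0\<^sub>v d"
      unfolding det_0_iff_vec_prod_zero[OF H] by blast
    define w where "w g k = (\<Sum>j<d. r g $$ (k, j) * v $ j)" for g k
    \<comment> \<open>The value of the invariant form at \<open>v\<close> is the sum of the squared norms of all \<open>r g v\<close>.\<close>
    have "(\<Sum>g\<in>carrier G. \<Sum>k<d. cnj (w g k) * w g k) =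
        (\<Sum>g\<in>carrier G. \<Sum>k<d. \<Sum>i<d. \<Sum>j<d. cnj (v $ i) * (cnj (r g $$ (k, i)) * r g $$ (k, j) * v $ j))"
      unfolding w_def cnj_sum sum_product complex_cnj_mult by (simp only: mult_ac)
    also have "\<dots> = (\<Sum>g\<in>carrier G. \<Sum>i<d. \<Sum>k<d. \<Sum>j<d. cnj (v $ i) * (cnj (r g $$ (k, i)) * r g $$ (k, j) * v $ j))"
      by (intro sum.cong refl sum.swap)
    also have "\<dots> = (\<Sum>i<d. \<Sum>g\<in>carrier G. \<Sum>k<d. \<Sum>j<d. cnj (v $ i) * (cnj (r g $$ (k, i)) * r g $$ (k, j) * v $ j))"
      by (rule sum.swap)
    also have "\<dots> = (\<Sum>i<d. \<Sum>g\<in>carrier G. \<Sum>j<d. \<Sum>k<d. cnj (v $ i) * (cnj (r g $$ (k, i)) * r g $$ (k, j) * v $ j))"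
      by (intro sum.cong refl sum.swap)
    also have "\<dots> = (\<Sum>i<d. \<Sum>j<d. \<Sum>g\<in>carrier G. \<Sum>k<d. cnj (v $ i) * (cnj (r g $$ (k, i)) * r g $$ (k, j) * v $ j))"
      by (intro sum.cong refl sum.swap)
    also have "\<dots> = (\<Sum>i<d. cnj (v $ i) * (\<Sum>j<d. H $$ (i, j) * v $ j))"
      by (intro sum.cong refl) (simp add: entryH sum_distrib_left sum_distrib_right)
    also have "\<dots> = (\<Sum>i<d. cnj (v $ i) * (H *\<^sub>v v) $ i)"
      using H v(1) by (intro sum.cong refl) (auto simp: scalar_prod_def atLeast0LessThan intro!: sum.cong)
    also have "\<dots> = 0" unfolding v(3) by simp
    finally have "(\<Sum>g\<in>carrier G. \<Sum>k<d. cnj (w g k) * w g k) = 0" .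
    then have "complex_of_real (\<Sum>g\<in>carrier G. \<Sum>k<d. (norm (w g k))\<^sup>2) = 0"
      by (simp only: of_real_sum complex_norm_square mult.commute)
    then have "(\<Sum>g\<in>carrier G. \<Sum>k<d. (norm (w g k))\<^sup>2) = 0" by (simp only: of_real_eq_0_iff)
    then have "(\<Sum>k<d. (norm (w \<one>\<^bsub>G\<^esub> k))\<^sup>2) = 0"
      using assms(2) by (subst (asm) sum_nonneg_eq_0_iff) (auto intro: sum_nonneg)
    then have "w \<one>\<^bsub>G\<^esub> k = 0" if "k < d" for k
      using that by (subst (asm) sum_nonneg_eq_0_iff) auto
    moreover have "w \<one>\<^bsub>G\<^esub> k = v $ k" if "k < d" for k
    proof -
      have "w \<one>\<^bsub>G\<^esub> k = (\<Sum>j<d. if j = k then v $ j else 0)"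
        unfolding w_def using that by (intro sum.cong refl) (auto simp: is_repD(2)[OF rep])
      then show ?thesis using that by simp
    qed
    ultimately show False using v(1,2) by (metis carrier_vecD eq_vecI index_zero_vec)
  qed
  ultimately have "mat_trace (r (inv\<^bsub>G\<^esub> h)) = mat_trace A"
    using det_nonzero_obtain_inverse[OF H] invertible_matI[OF H] mat_trace_conjugate[OF H _ rih A]
    by metis
  also have "\<dots> = cnj (mat_trace (r h))"
    unfolding mat_trace_def A_def using rh by simp
  finally show ?thesis .
qed

lemma Irr_cases:
  assumes "c \<in> Irr G"
  obtains d r where "irreducible_rep G (d, r)" "is_rep G (d, r)" "0 < d" "c = iso_class G (d, r)"
    "\<And>g. g \<in> carrier G \<Longrightarrow> class_char c g = mat_trace (r g)"
proof -
  obtain R where R: "irreducible_rep G R" "c = iso_class G R" using assms unfolding Irr_def by auto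
  obtain d r where dr: "R = (d, r)" by (cases R)
  have rep: "is_rep G (d, r)" "0 < d" using R(1) unfolding irreducible_rep_def dr by auto
  show ?thesis
    using that[of d r] R rep class_char_iso_class[OF rep(1)] unfolding dr by simp
qed

theorem irreducible_character_orthogonality:
  assumes "group G" "finite (carrier G)" and c: "c \<in> Irr G" and c': "c' \<in> Irr G"
  shows "(\<Sum>g\<in>carrier G. cnj (class_char c g) * class_char c' g) =
    (if c = c' then of_nat (card (carrier G)) else 0)"
proof -
  interpret group G by fact
  obtain d r where r: "irreducible_rep G (d, r)" "is_rep G (d, r)" "c = iso_class G (d, r)"
    "\<And>g. g \<in> carrier G \<Longrightarrow> class_char c g = mat_trace (r g)" using Irr_cases[OF c] by metis
  have sum: "(\<Sum>g\<in>carrier G. cnj (class_char c g) * class_char c' g) =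
      (\<Sum>g\<in>carrier G. mat_trace (s g) * mat_trace (r (inv\<^bsub>G\<^esub> g)))"
    if "\<And>g. g \<in> carrier G \<Longrightarrow> class_char c' g = mat_trace (s g)" for s :: "'a \<Rightarrow> complex mat"
    using that r(4) trace_inverse[OF assms(1,2) r(2)]
    by (intro sum.cong refl) (simp add: mult.commute)
  show ?thesis
  proof (cases "c = c'")
    case True
    then show ?thesis using sum[of r] r(4) sum_trace_product_self[OF assms(1) r(1)] by simp
  next
    case False
    obtain e s where s: "irreducible_rep G (e, s)" "c' = iso_class G (e, s)"
      "\<And>g. g \<in> carrier G \<Longrightarrow> class_char c' g = mat_trace (s g)" using Irr_cases[OF c'] by metis
    then show ?thesis
      using False sum[of s] sum_trace_product_nonisomorphic[OF assms(1) s(1) r(1)] r(3) by simp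
  qed
qed

lemma class_char_one:
  assumes "group G" "c \<in> Irr G"
  obtains d :: nat where "0 < d" "class_char c \<one>\<^bsub>G\<^esub> = of_nat d"
proof -
  obtain d r where r: "is_rep G (d, r)" "0 < d"
    "\<And>g. g \<in> carrier G \<Longrightarrow> class_char c g = mat_trace (r g)" using Irr_cases[OF assms(2)] by metis
  have "\<one>\<^bsub>G\<^esub> \<in> carrier G" using assms(1) by (simp add: group.is_monoid)
  then show ?thesis using that r by (simp add: is_repD(2)[OF r(1)] mat_trace_one)
qed

text \<open>Bessel's inequality for the delta function at the identity and the orthogonal family of
  irreducible characters: any finite set of irreducible classes has degrees whose squares sum to at
  most \<open>|G|\<close>. Finiteness matters because the top part is a sum over all irreducible classes, and a
  sum over an infinite set would be zero by convention.\<close>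

lemma finite_Irr:
  assumes "group G" "finite (carrier G)"
  shows "finite (Irr G)"
proof (rule conjunct1[OF finite_if_finite_subsets_card_bdd])
  fix F assume F: "F \<subseteq> Irr G" "finite F"
  interpret group G by fact
  define n :: complex where "n = of_nat (card (carrier G))"
  have "card (carrier G) > 0" using assms(2) one_closed card_gt_0_iff by blast
  then have n0: "n \<noteq> 0" unfolding n_def by simp
  have "\<exists>d::nat. 0 < d \<and> class_char c \<one>\<^bsub>G\<^esub> = of_nat d" if c: "c \<in> F" for c
  proof -
    obtain d :: nat where "0 < d" "class_char c \<one>\<^bsub>G\<^esub> = of_nat d"
      using class_char_one[OF assms(1) subsetD[OF F(1) c]] .
    then show ?thesis by blast
  qed
  then obtain deg :: "'a rep set \<Rightarrow> nat" where deg: "\<And>c. c \<in> F \<Longrightarrow> 0 < deg c"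
    "\<And>c. c \<in> F \<Longrightarrow> class_char c \<one>\<^bsub>G\<^esub> = of_nat (deg c)" by metis
  \<comment> \<open>Up to the factor \<open>|G|\<close>, this is the orthogonal projection of the delta function to the span of \<open>F\<close>.\<close>
  define s where "s g = (\<Sum>c\<in>F. of_nat (deg c) * class_char c g)" for g
  define D where "D = (\<Sum>c\<in>F. (deg c)\<^sup>2)"
  define \<delta> where "\<delta> g = (if g = \<one>\<^bsub>G\<^esub> then n else 0)" for g
  have s1: "s \<one>\<^bsub>G\<^esub> = of_nat D"
    unfolding s_def D_def by (simp add: deg(2) power2_eq_square)
  have ss: "(\<Sum>g\<in>carrier G. cnj (s g) * s g) = n * of_nat D"
  proof -
    have "(\<Sum>g\<in>carrier G. cnj (s g) * s g) = (\<Sum>g\<in>carrier G. \<Sum>c\<in>F. \<Sum>c'\<in>F.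
        (of_nat (deg c) * of_nat (deg c')) * (cnj (class_char c g) * class_char c' g))"
      unfolding s_def cnj_sum sum_product complex_cnj_mult complex_cnj_of_nat by (simp only: mult_ac)
    also have "\<dots> = (\<Sum>c\<in>F. \<Sum>g\<in>carrier G. \<Sum>c'\<in>F.
        (of_nat (deg c) * of_nat (deg c')) * (cnj (class_char c g) * class_char c' g))"
      by (rule sum.swap)
    also have "\<dots> = (\<Sum>c\<in>F. \<Sum>c'\<in>F. \<Sum>g\<in>carrier G.
        (of_nat (deg c) * of_nat (deg c')) * (cnj (class_char c g) * class_char c' g))"
      by (intro sum.cong refl sum.swap)
    also have "\<dots> = (\<Sum>c\<in>F. \<Sum>c'\<in>F. (of_nat (deg c) * of_nat (deg c')) * (if c = c' then n else 0))"
      unfolding sum_distrib_left[symmetric] n_def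
      using F(1) by (intro sum.cong refl) (simp add: irreducible_character_orthogonality[OF assms] subset_iff)
    also have "\<dots> = (\<Sum>c\<in>F. of_nat (deg c) * of_nat (deg c) * n)"
      using F(2) by (intro sum.cong refl) (simp add: if_distrib[of "(*) _"] cong: if_cong)
    also have "\<dots> = n * of_nat D"
      unfolding D_def by (simp add: sum_distrib_left power2_eq_square mult_ac)
    finally show ?thesis .
  qed
  have \<delta>: "(\<Sum>g\<in>carrier G. cnj (\<delta> g) * f g) = n * f \<one>\<^bsub>G\<^esub>"
    "(\<Sum>g\<in>carrier G. cnj (f g) * \<delta> g) = n * cnj (f \<one>\<^bsub>G\<^esub>)" for f
    using assms(2) unfolding \<delta>_def n_def
    by (simp_all add: if_distrib[of cnj] if_distrib[of "\<lambda>x. x * _"] if_distrib[of "(*) _"] sum.delta' mult.commute cong: if_cong)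
  have "(\<Sum>g\<in>carrier G. cnj (\<delta> g - s g) * (\<delta> g - s g)) =
      (\<Sum>g\<in>carrier G. cnj (\<delta> g) * \<delta> g) - (\<Sum>g\<in>carrier G. cnj (\<delta> g) * s g)
      - (\<Sum>g\<in>carrier G. cnj (s g) * \<delta> g) + (\<Sum>g\<in>carrier G. cnj (s g) * s g)"
    by (simp add: algebra_simps sum.distrib sum_subtractf)
  also have "\<dots> = n * n - n * of_nat D"
    unfolding \<delta> ss s1 by (simp add: \<delta>_def)
  also have "(\<Sum>g\<in>carrier G. cnj (\<delta> g - s g) * (\<delta> g - s g)) =
      complex_of_real (\<Sum>g\<in>carrier G. (norm (\<delta> g - s g))\<^sup>2)"
    by (simp only: of_real_sum complex_norm_square mult.commute)
  finally have "complex_of_real (\<Sum>g\<in>carrier G. (norm (\<delta> g - s g))\<^sup>2) =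
      complex_of_real (real (card (carrier G)) * (real (card (carrier G)) - real D))"
    unfolding n_def by (simp add: algebra_simps)
  then have "(\<Sum>g\<in>carrier G. (norm (\<delta> g - s g))\<^sup>2) =
      real (card (carrier G)) * (real (card (carrier G)) - real D)"
    by (simp only: of_real_eq_iff)
  moreover have "0 \<le> (\<Sum>g\<in>carrier G. (norm (\<delta> g - s g))\<^sup>2)" by (intro sum_nonneg) simp
  ultimately have "real (card (carrier G)) * (real (card (carrier G)) - real D) \<ge> 0" by simp
  then have "D \<le> card (carrier G)"
    using \<open>card (carrier G) > 0\<close> by (simp add: zero_le_mult_iff)
  moreover have "card F \<le> D"
    unfolding D_def card_eq_sum using deg(1) by (intro sum_mono) (simp add: Suc_leI)
  ultimately show "card F \<le> card (carrier G)" by simp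
qed

section \<open>Conjugacy classes\<close>

lemma conj_class_eq_iff:
  assumes "group G" "x \<in> carrier G" "y \<in> carrier G"
  shows "conj_class G x = conj_class G y \<longleftrightarrow> x \<in> conj_class G y"
proof -
  interpret group G by fact
  have self: "x \<in> conj_class G x" if "x \<in> carrier G" for x
    unfolding conj_class_def using that by (force intro: exI[of _ "\<one>\<^bsub>G\<^esub>"])
  have sub: "conj_class G x \<subseteq> conj_class G y" if xy: "x \<in> conj_class G y" "y \<in> carrier G" for x y
  proof
    fix z assume "z \<in> conj_class G x"
    then obtain h where h: "h \<in> carrier G" "z = h \<otimes>\<^bsub>G\<^esub> x \<otimes>\<^bsub>G\<^esub> inv\<^bsub>G\<^esub> h"
      unfolding conj_class_def by auto
    obtain k where k: "k \<in> carrier G" "x = k \<otimes>\<^bsub>G\<^esub> y \<otimes>\<^bsub>G\<^esub> inv\<^bsub>G\<^esub> k"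
      using xy(1) unfolding conj_class_def by blast
    have "z = (h \<otimes>\<^bsub>G\<^esub> k) \<otimes>\<^bsub>G\<^esub> y \<otimes>\<^bsub>G\<^esub> inv\<^bsub>G\<^esub> (h \<otimes>\<^bsub>G\<^esub> k)"
      unfolding h(2) k(2) using h(1) k(1) that(2) by (simp add: m_assoc inv_mult_group)
    then show "z \<in> conj_class G y" unfolding conj_class_def using h(1) k(1) by blast
  qed
  have sym: "y \<in> conj_class G x" if xy: "x \<in> conj_class G y" "y \<in> carrier G" for x y
  proof -
    obtain k where k: "k \<in> carrier G" "x = k \<otimes>\<^bsub>G\<^esub> y \<otimes>\<^bsub>G\<^esub> inv\<^bsub>G\<^esub> k"
      using xy(1) unfolding conj_class_def by blast
    have "y = inv\<^bsub>G\<^esub> k \<otimes>\<^bsub>G\<^esub> x \<otimes>\<^bsub>G\<^esub> inv\<^bsub>G\<^esub> (inv\<^bsub>G\<^esub> k)"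
      unfolding k(2) using k(1) that(2) by (simp add: m_assoc inv_solve_left)
    then show ?thesis unfolding conj_class_def using k(1) by blast
  qed
  show ?thesis using self sub sym assms(2,3) by (metis subset_antisym)
qed

lemma class_char_conj:
  assumes "group G" "c \<in> Irr G" "x \<in> carrier G" "y \<in> conj_class G x"
  shows "class_char c y = class_char c x"
proof -
  interpret group G by fact
  obtain d r where r: "is_rep G (d, r)"
    "\<And>g. g \<in> carrier G \<Longrightarrow> class_char c g = mat_trace (r g)" using Irr_cases[OF assms(2)] by metis
  obtain k where k: "k \<in> carrier G" "y = k \<otimes>\<^bsub>G\<^esub> x \<otimes>\<^bsub>G\<^esub> inv\<^bsub>G\<^esub> k"
    using assms(4) unfolding conj_class_def by auto
  have "mat_trace (r y) = mat_trace (r (k \<otimes>\<^bsub>G\<^esub> x) * r (inv\<^bsub>G\<^esub> k))"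
    unfolding k(2) using k(1) assms(3) by (simp add: is_repD(3)[OF r(1)])
  also have "\<dots> = mat_trace (r (inv\<^bsub>G\<^esub> k) * r (k \<otimes>\<^bsub>G\<^esub> x))"
    using k(1) assms(3) by (intro mat_trace_mult_comm[of _ d d]) (auto intro: is_repD(1)[OF r(1)])
  also have "\<dots> = mat_trace (r (inv\<^bsub>G\<^esub> k \<otimes>\<^bsub>G\<^esub> (k \<otimes>\<^bsub>G\<^esub> x)))"
    using k(1) assms(3) by (simp add: is_repD(3)[OF r(1)])
  also have "inv\<^bsub>G\<^esub> k \<otimes>\<^bsub>G\<^esub> (k \<otimes>\<^bsub>G\<^esub> x) = x"
    using k(1) assms(3) by (simp flip: m_assoc)
  finally show ?thesis using r(2) assms(3) k by simp
qed

lemma sum_conj_classes: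
  fixes f :: "'g \<Rightarrow> complex"
  assumes "group G" "finite (carrier G)"
    and f: "\<And>x y. x \<in> carrier G \<Longrightarrow> y \<in> conj_class G x \<Longrightarrow> f y = f x"
  shows "(\<Sum>C\<in>conj_classes G. of_nat (card C) * f (elt C)) = (\<Sum>x\<in>carrier G. f x)"
proof -
  interpret group G by fact
  have "(\<Sum>x\<in>carrier G. f x) =
      (\<Sum>C\<in>conj_classes G. \<Sum>x\<in>{x \<in> carrier G. conj_class G x = C}. f x)"
    unfolding conj_classes_def by (rule sum.image_gen[OF assms(2)])
  also have "\<dots> = (\<Sum>C\<in>conj_classes G. of_nat (card C) * f (elt C))"
  proof (intro sum.cong refl)
    fix C assume "C \<in> conj_classes G"
    then obtain y where y: "y \<in> carrier G" "C = conj_class G y" unfolding conj_classes_def by auto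
    have sub: "C \<subseteq> carrier G" unfolding y(2) conj_class_def using y(1) by auto
    have C: "{x \<in> carrier G. conj_class G x = C} = C"
      using sub conj_class_eq_iff[OF assms(1) _ y(1)] unfolding y(2) by auto
    have "y \<in> C" using conj_class_eq_iff[OF assms(1) y(1) y(1)] unfolding y(2) by simp
    then have "elt C \<in> C" unfolding elt_def by (rule someI)
    then have "f x = f (elt C)" if "x \<in> C" for x using f[OF y(1)] that unfolding y(2) by metis
    then show "(\<Sum>x\<in>{x \<in> carrier G. conj_class G x = C}. f x) = of_nat (card C) * f (elt C)"
      unfolding C by simp
  qed
  finally show ?thesis ..
qed

lemma elt_conj_class:
  assumes "group G" "C \<in> conj_classes G"
  shows "elt C \<in> carrier G"
proof -
  interpret group G by fact
  obtain y where y: "y \<in> carrier G" "C = conj_class G y" using assms(2) unfolding conj_classes_def by auto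
  have "y \<in> C" using conj_class_eq_iff[OF assms(1) y(1) y(1)] unfolding y(2) by simp
  then have "elt C \<in> C" unfolding elt_def by (rule someI)
  then show ?thesis unfolding y(2) conj_class_def using y(1) by auto
qed

lemma orthogonality_on_conj_classes:
  assumes "group G" "finite (carrier G)" and c: "c \<in> Irr G" and c': "c' \<in> Irr G"
  shows "(\<Sum>C\<in>conj_classes G. of_nat (card C) / of_nat (Coset.order G) *
      cnj (class_char c (elt C)) * class_char c' (elt C)) = (if c = c' then 1 else 0)"
proof -
  interpret group G by fact
  have "card (carrier G) > 0" using assms(2) one_closed card_gt_0_iff by blast
  have "(\<Sum>C\<in>conj_classes G. of_nat (card C) / of_nat (Coset.order G) *
      cnj (class_char c (elt C)) * class_char c' (elt C)) =
    (\<Sum>C\<in>conj_classes G. of_nat (card C) * (cnj (class_char c (elt C)) * class_char c' (elt C)))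
      / of_nat (card (carrier G))"
    by (simp add: sum_divide_distrib Coset.order_def mult.assoc)
  also have "(\<Sum>C\<in>conj_classes G. of_nat (card C) * (cnj (class_char c (elt C)) * class_char c' (elt C)))
      = (\<Sum>x\<in>carrier G. cnj (class_char c x) * class_char c' x)"
    by (rule sum_conj_classes[OF assms(1,2), where f = "\<lambda>x. cnj (class_char c x) * class_char c' x"])
      (simp add: class_char_conj[OF assms(1) c] class_char_conj[OF assms(1) c'])
  finally show ?thesis
    using \<open>card (carrier G) > 0\<close> unfolding irreducible_character_orthogonality[OF assms] by simp
qed

section \<open>Tensor products and virtual characters\<close>

lemma sum_div_mod:
  fixes f :: "nat \<Rightarrow> nat \<Rightarrow> 'a::comm_monoid_add"
  shows "(\<Sum>k<m * n. f (k div n) (k mod n)) = (\<Sum>i<m. \<Sum>j<n. f i j)"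
proof -
  have "(\<Sum>k<m * n. f (k div n) (k mod n)) = (\<Sum>(i, j)\<in>{..<m} \<times> {..<n}. f i j)"
  proof (rule sum.reindex_bij_witness[of _ "\<lambda>(i, j). i * n + j" "\<lambda>k. (k div n, k mod n)"])
    fix k assume k: "k \<in> {..<m * n}"
    then have "0 < n" by (cases n) auto
    then show "(k div n, k mod n) \<in> {..<m} \<times> {..<n}"
      using k by (simp add: less_mult_imp_div_less)
  next
    fix p assume "p \<in> {..<m} \<times> {..<n}"
    then obtain i j where p: "p = (i, j)" "i < m" "j < n" by auto
    have "i * n + j < Suc i * n" using p(3) by simp
    also have "\<dots> \<le> m * n" using p(2) by (intro mult_le_mono1) simp
    finally show "(case p of (i, j) \<Rightarrow> i * n + j) \<in> {..<m * n}" using p(1) by simp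
  qed auto
  then show ?thesis by (simp add: sum.cartesian_product)
qed

lemma kronecker_carrier:
  "A \<in> carrier_mat a a' \<Longrightarrow> B \<in> carrier_mat b b' \<Longrightarrow> kronecker A B \<in> carrier_mat (a * b) (a' * b')"
  unfolding kronecker_def by auto

lemma kronecker_entry:
  "A \<in> carrier_mat a a' \<Longrightarrow> B \<in> carrier_mat b b' \<Longrightarrow> i < a * b \<Longrightarrow> j < a' * b' \<Longrightarrow>
    kronecker A B $$ (i, j) = A $$ (i div b, j div b') * B $$ (i mod b, j mod b')"
  unfolding kronecker_def by auto

lemma div_mod_bounds:
  fixes i :: nat
  assumes "i < a * b"
  shows "i div b < a" "i mod b < b"
proof -
  have "0 < b" using assms by (cases b) auto
  then show "i div b < a" "i mod b < b" using assms by (simp_all add: less_mult_imp_div_less)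
qed

lemma kronecker_mult:
  fixes A A' B B' :: "'a::comm_semiring_0 mat"
  assumes A: "A \<in> carrier_mat a a" "A' \<in> carrier_mat a a"
    and B: "B \<in> carrier_mat b b" "B' \<in> carrier_mat b b"
  shows "kronecker (A * A') (B * B') = kronecker A B * kronecker A' B'"
proof (rule eq_matI)
  note K = kronecker_carrier[OF A(1) B(1)] and K' = kronecker_carrier[OF A(2) B(2)]
  have AA: "A * A' \<in> carrier_mat a a" and BB: "B * B' \<in> carrier_mat b b" using A B by auto
  fix i j assume "i < dim_row (kronecker A B * kronecker A' B')"
    "j < dim_col (kronecker A B * kronecker A' B')"
  then have ij: "i < a * b" "j < a * b" using K K' by auto
  note bi = div_mod_bounds[OF ij(1)] and bj = div_mod_bounds[OF ij(2)]
  have "kronecker (A * A') (B * B') $$ (i, j) =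
      (\<Sum>k<a. \<Sum>l<b. (A $$ (i div b, k) * A' $$ (k, j div b)) * (B $$ (i mod b, l) * B' $$ (l, j mod b)))"
    unfolding kronecker_entry[OF AA BB ij] mat_mult_entry[OF A bi(1) bj(1)]
      mat_mult_entry[OF B bi(2) bj(2)] by (rule sum_product)
  also have "\<dots> = (\<Sum>k<a * b. (A $$ (i div b, k div b) * A' $$ (k div b, j div b)) *
      (B $$ (i mod b, k mod b) * B' $$ (k mod b, j mod b)))"
    by (rule sum_div_mod[symmetric])
  also have "\<dots> = (\<Sum>k<a * b. kronecker A B $$ (i, k) * kronecker A' B' $$ (k, j))"
    using ij by (intro sum.cong refl)
      (simp add: kronecker_entry[OF A(1) B(1)] kronecker_entry[OF A(2) B(2)] mult_ac)
  also have "\<dots> = (kronecker A B * kronecker A' B') $$ (i, j)"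
    by (rule mat_mult_entry[OF K K' ij, symmetric])
  finally show "kronecker (A * A') (B * B') $$ (i, j) = (kronecker A B * kronecker A' B') $$ (i, j)" .
qed (use A B in \<open>auto simp: kronecker_def\<close>)

lemma kronecker_one:
  "kronecker (1\<^sub>m a) (1\<^sub>m b) = (1\<^sub>m (a * b) :: 'a::semiring_1 mat)"
proof (rule eq_matI)
  fix i j assume "i < dim_row (1\<^sub>m (a * b) :: 'a mat)" "j < dim_col (1\<^sub>m (a * b) :: 'a mat)"
  then have ij: "i < a * b" "j < a * b" by auto
  have "i = j \<longleftrightarrow> i div b = j div b \<and> i mod b = j mod b" by (metis div_mult_mod_eq)
  then show "kronecker (1\<^sub>m a) (1\<^sub>m b) $$ (i, j) = (1\<^sub>m (a * b) :: 'a mat) $$ (i, j)"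
    using ij div_mod_bounds[OF ij(1)] div_mod_bounds[OF ij(2)] unfolding kronecker_def by auto
qed (auto simp: kronecker_def)

lemma kronecker_trace:
  fixes A B :: "'a::comm_semiring_0 mat"
  assumes "A \<in> carrier_mat a a" "B \<in> carrier_mat b b"
  shows "mat_trace (kronecker A B) = mat_trace A * mat_trace B"
proof -
  have "mat_trace (kronecker A B) = (\<Sum>k<a * b. A $$ (k div b, k div b) * B $$ (k mod b, k mod b))"
    using kronecker_carrier[OF assms] unfolding mat_trace_def
    by (intro sum.cong) (auto simp: kronecker_entry[OF assms])
  also have "\<dots> = (\<Sum>i<a. \<Sum>j<b. A $$ (i, i) * B $$ (j, j))" by (rule sum_div_mod)
  also have "\<dots> = mat_trace A * mat_trace B"
    using assms unfolding mat_trace_def by (simp add: sum_product)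
  finally show ?thesis .
qed

lemma is_rep_tensor_rep:
  assumes "is_rep G R" "is_rep H S"
  shows "is_rep (G \<times>\<times> H) (tensor_rep R S)"
proof -
  obtain d r where R: "R = (d, r)" by (cases R)
  obtain e s where S: "S = (e, s)" by (cases S)
  note r = is_repD[OF assms(1)[unfolded R]] and s = is_repD[OF assms(2)[unfolded S]]
  show ?thesis unfolding is_rep_def tensor_rep_def R S
    by (auto simp: DirProd_def r s kronecker_one intro!: kronecker_carrier kronecker_mult[of _ d _ _ e])
qed

lemma class_char_tensor_class:
  assumes "c \<in> rep_classes G" "d \<in> rep_classes H" "g \<in> carrier G" "h \<in> carrier H"
  shows "class_char (tensor_class G H c d) (g, h) = class_char c g * class_char d h"
proof -
  define R where "R = (SOME R. R \<in> c)"
  define S where "S = (SOME S. S \<in> d)"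
  have R: "is_rep G R" and S: "is_rep H S"
    unfolding R_def S_def using assms(1,2) by (auto intro: is_rep_some_member)
  have "snd R g \<in> carrier_mat (fst R) (fst R)" "snd S h \<in> carrier_mat (fst S) (fst S)"
    using is_repD(1)[of G "fst R" "snd R" g] is_repD(1)[of H "fst S" "snd S" h] R S assms(3,4) by auto
  then have "mat_trace (snd (tensor_rep R S) (g, h)) = mat_trace (snd R g) * mat_trace (snd S h)"
    unfolding tensor_rep_def by (simp add: kronecker_trace)
  then show ?thesis
    unfolding tensor_class_def R_def[symmetric] S_def[symmetric]
      class_char_def[of c] class_char_def[of d]
    using class_char_iso_class[OF is_rep_tensor_rep[OF R S], of "(g, h)"] assms(3,4)
    by (simp add: DirProd_def)
qed

lemma virtual_char_superset:
  assumes "finite A" "Poly_Mapping.keys x \<subseteq> A"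
  shows "\<chi> x g = (\<Sum>c\<in>A. of_int (Poly_Mapping.lookup x c) * class_char c g)"
  unfolding virtual_char_def using assms
  by (intro sum.mono_neutral_left) (auto simp: in_keys_iff)

lemma virtual_char_frag_of [simp]: "\<chi> (frag_of c) g = class_char c g"
  by (simp add: virtual_char_def)

lemma virtual_char_cmul: "\<chi> (frag_cmul k x) g = of_int k * \<chi> x g"
  by (subst (1 2) virtual_char_superset[of "Poly_Mapping.keys x"])
    (auto simp: keys_cmul sum_distrib_left mult.assoc)

lemma virtual_char_add: "\<chi> (x + y) g = \<chi> x g + \<chi> y g"
  by (subst (1 2 3) virtual_char_superset[of "Poly_Mapping.keys x \<union> Poly_Mapping.keys y"])
    (use keys_add[of x y] in \<open>auto simp: lookup_add distrib_right sum.distrib\<close>)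

lemma virtual_char_sum: "\<chi> (\<Sum>i\<in>I. x i) g = (\<Sum>i\<in>I. \<chi> (x i) g)"
proof -
  have "\<chi> 0 g = 0" by (simp add: virtual_char_def)
  then show ?thesis by (induction I rule: infinite_finite_induct) (auto simp: virtual_char_add)
qed

lemma virtual_char_frag_extend:
  "\<chi> (frag_extend b x) g =
    (\<Sum>c\<in>Poly_Mapping.keys x. of_int (Poly_Mapping.lookup x c) * \<chi> (b c) g)"
  by (simp add: frag_extend_def virtual_char_sum virtual_char_cmul)

lemma virtual_char_virtual_tensor:
  assumes "Poly_Mapping.keys x \<subseteq> rep_classes G" "Poly_Mapping.keys y \<subseteq> rep_classes H"
    and "g \<in> carrier G" "h \<in> carrier H"
  shows "\<chi> (virtual_tensor G H x y) (g, h) = \<chi> x g * \<chi> y h"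
proof -
  have "\<chi> (virtual_tensor G H x y) (g, h) =
      (\<Sum>c\<in>Poly_Mapping.keys x. of_int (Poly_Mapping.lookup x c) * (\<Sum>d\<in>Poly_Mapping.keys y.
        of_int (Poly_Mapping.lookup y d) * (class_char c g * class_char d h)))"
    unfolding virtual_tensor_def virtual_char_frag_extend virtual_char_frag_of
    using assms by (intro sum.cong refl arg_cong2[of _ _ _ _ "(*)"] class_char_tensor_class) auto
  also have "\<dots> = \<chi> x g * \<chi> y h"
    unfolding virtual_char_def[of x] virtual_char_def[of y] sum_product
    by (simp only: sum_distrib_left mult_ac)
  finally show ?thesis .
qed

text \<open>Pairing \<open>\<Sum>d. V d \<otimes> d\<close> with the character of \<open>c\<close> on the second factor extracts the coefficient
  \<open>V c\<close>, by orthogonality.\<close>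

lemma virtual_char_tensor_sum_right:
  assumes H: "group H" "finite (carrier H)" and c: "c \<in> Irr H" and g: "g \<in> carrier G"
    and V: "\<And>d. d \<in> Irr H \<Longrightarrow> Poly_Mapping.keys (V d) \<subseteq> rep_classes G"
  shows "(\<Sum>C\<in>conj_classes H. of_nat (card C) / of_nat (Coset.order H) * cnj (\<chi> (frag_of c) (elt C)) *
      \<chi> (\<Sum>d\<in>Irr H. virtual_tensor G H (V d) (frag_of d)) (g, elt C)) = \<chi> (V c) g"
proof -
  have "\<chi> (\<Sum>d\<in>Irr H. virtual_tensor G H (V d) (frag_of d)) (g, elt C) =
      (\<Sum>d\<in>Irr H. \<chi> (V d) g * class_char d (elt C))" if "C \<in> conj_classes H" for C
    unfolding virtual_char_sum
    using V g elt_conj_class[OF H(1) that] Irr_subset_rep_classes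
    by (intro sum.cong refl) (subst virtual_char_virtual_tensor, auto)
  then have "(\<Sum>C\<in>conj_classes H. of_nat (card C) / of_nat (Coset.order H) * cnj (\<chi> (frag_of c) (elt C)) *
      \<chi> (\<Sum>d\<in>Irr H. virtual_tensor G H (V d) (frag_of d)) (g, elt C)) =
    (\<Sum>C\<in>conj_classes H. \<Sum>d\<in>Irr H. \<chi> (V d) g * (of_nat (card C) / of_nat (Coset.order H) *
      cnj (class_char c (elt C)) * class_char d (elt C)))"
    by (intro sum.cong refl) (simp add: sum_distrib_left sum_divide_distrib mult_ac)
  also have "\<dots> = (\<Sum>d\<in>Irr H. \<chi> (V d) g * (\<Sum>C\<in>conj_classes H. of_nat (card C) / of_nat (Coset.order H) *
      cnj (class_char c (elt C)) * class_char d (elt C)))"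
    unfolding sum_distrib_left by (rule sum.swap)
  also have "\<dots> = (\<Sum>d\<in>Irr H. if c = d then \<chi> (V d) g else 0)"
    by (intro sum.cong refl) (simp only: orthogonality_on_conj_classes[OF H c], simp)
  also have "\<dots> = \<chi> (V c) g" using finite_Irr[OF H] c by simp
  finally show ?thesis .
qed

text \<open>The roles of the two factors may be exchanged, since the character of a tensor product is a
  commutative product.\<close>

lemma virtual_char_tensor_sum_left:
  assumes G: "group G" "finite (carrier G)" and c: "c \<in> Irr G" and h: "h \<in> carrier H"
    and V: "\<And>d. d \<in> Irr G \<Longrightarrow> Poly_Mapping.keys (V d) \<subseteq> rep_classes H"
  shows "(\<Sum>C\<in>conj_classes G. of_nat (card C) / of_nat (Coset.order G) * cnj (\<chi> (frag_of c) (elt C)) *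
      \<chi> (\<Sum>d\<in>Irr G. virtual_tensor G H (frag_of d) (V d)) (elt C, h)) = \<chi> (V c) h"
proof -
  have "\<chi> (\<Sum>d\<in>Irr G. virtual_tensor G H (frag_of d) (V d)) (elt C, h) =
      \<chi> (\<Sum>d\<in>Irr G. virtual_tensor H G (V d) (frag_of d)) (h, elt C)" if "C \<in> conj_classes G" for C
    unfolding virtual_char_sum
    using V h elt_conj_class[OF G(1) that] Irr_subset_rep_classes
    by (intro sum.cong refl) (subst (1 2) virtual_char_virtual_tensor, auto)
  then show ?thesis
    using virtual_char_tensor_sum_right[where G = H and H = G and V = V, OF G c h V] by simp
qed

section \<open>Isometry groups\<close>

lemma finite_carrier_mat: "finite (carrier_mat n k :: 'a::finite mat set)"
proof -
  have "carrier_mat n k \<subseteq> (mat n k :: _ \<Rightarrow> 'a mat) ` (({..<n} \<times> {..<k}) \<rightarrow>\<^sub>E UNIV)"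
  proof
    fix A :: "'a mat" assume A: "A \<in> carrier_mat n k"
    have "A = mat n k (restrict (\<lambda>p. A $$ p) ({..<n} \<times> {..<k}))"
      using A by (intro eq_matI) auto
    moreover have "restrict (\<lambda>p. A $$ p) ({..<n} \<times> {..<k}) \<in> ({..<n} \<times> {..<k}) \<rightarrow>\<^sub>E UNIV" by simp
    ultimately show "A \<in> mat n k ` (({..<n} \<times> {..<k}) \<rightarrow>\<^sub>E UNIV)" by blast
  qed
  then show ?thesis by (rule finite_subset) (intro finite_imageI finite_PiE; simp)
qed

lemma isometry_mult:
  fixes F :: "'a::field mat"
  assumes "F \<in> carrier_mat n n" "A \<in> carrier_mat n n" "A' \<in> carrier_mat n n"
  shows "(A * A')\<^sup>T * F * (A * A') = A'\<^sup>T * (A\<^sup>T * F * A) * A'"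
  using assms by (simp add: transpose_mult[of _ n n _ n] assoc_mult_mat[of _ n n _ n _ n])

lemma isometry_det:
  fixes F :: "'a::field mat"
  assumes F: "F \<in> carrier_mat n n" "det F \<noteq> 0" and A: "A \<in> carrier_mat n n" "A\<^sup>T * F * A = F"
  shows "det A = 1 \<or> det A = - 1"
proof -
  have "det F = det (A\<^sup>T * F) * det A"
    using det_mult[of "A\<^sup>T * F" n A] F(1) A by simp
  also have "det (A\<^sup>T * F) = det A * det F"
    using det_mult[of "A\<^sup>T" n F] det_transpose[OF A(1)] F(1) A(1) by simp
  finally have "det A * det A = 1" using F(2) by simp
  then show ?thesis by (simp add: square_eq_1_iff)
qed

lemma group_isometry_group:
  fixes F :: "'a::field mat"
  assumes F: "F \<in> carrier_mat n n" "det F \<noteq> 0"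
  shows "group (isometry_group F)"
proof (rule groupI)
  fix A A' assume "A \<in> carrier (isometry_group F)" "A' \<in> carrier (isometry_group F)"
  then show "A \<otimes>\<^bsub>isometry_group F\<^esub> A' \<in> carrier (isometry_group F)"
    using F unfolding isometry_group_def by (auto simp: isometry_mult[OF F(1)])
next
  show "\<one>\<^bsub>isometry_group F\<^esub> \<in> carrier (isometry_group F)"
    using F unfolding isometry_group_def by simp
next
  fix A assume "A \<in> carrier (isometry_group F)"
  then have A: "A \<in> carrier_mat n n" "A\<^sup>T * F * A = F" using F unfolding isometry_group_def by auto
  have "det A \<noteq> 0" using isometry_det[OF F A] by auto
  then obtain A' where A': "A' \<in> carrier_mat n n" "A * A' = 1\<^sub>m n" "A' * A = 1\<^sub>m n"
    using det_nonzero_obtain_inverse[OF A(1)] by blast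
  have "A'\<^sup>T * F * A' = F" using isometry_mult[OF F(1) A(1) A'(1)] A'(2) A(2) F(1) by simp
  then show "\<exists>A'\<in>carrier (isometry_group F). A' \<otimes>\<^bsub>isometry_group F\<^esub> A = \<one>\<^bsub>isometry_group F\<^esub>"
    using A' F unfolding isometry_group_def by auto
qed (use F in \<open>auto simp: isometry_group_def assoc_mult_mat[of _ n n _ n _ n]\<close>)

lemma finite_isometry_group: "finite (carrier (isometry_group (F :: 'a::{field,finite} mat)))"
  unfolding isometry_group_def
  by (rule finite_subset[OF _ finite_carrier_mat[of "dim_row F" "dim_row F"]]) auto

text \<open>In odd dimension \<open>-1\<close> has determinant \<open>-1\<close>, so an isometry \<open>A\<close> of determinant \<open>-1\<close> is the product
  of \<open>-1\<close> and the special isometry \<open>- A\<close>. Letting \<open>-1\<close> act by a scalar of square \<open>1\<close> is multiplicative.\<close>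

lemma is_rep_sign_extension:
  fixes F :: "'a::field mat"
  assumes F: "F \<in> carrier_mat n n" "det F \<noteq> 0" "odd n" and \<delta>: "\<delta> = 1 \<or> \<delta> = - 1"
    and R: "is_rep (special_isometry_group F) R"
  shows "is_rep (isometry_group F) (sign_extension \<delta> R)"
proof -
  obtain d r where dr: "R = (d, r)" by (cases R)
  note r = is_repD[OF R[unfolded dr]]
  let ?O = "{A \<in> carrier_mat n n. A\<^sup>T * F * A = F}" and ?S = "carrier (special_isometry_group F)"
  have S: "A \<in> ?S \<longleftrightarrow> A \<in> ?O \<and> det A = 1" for A
    using F(1) unfolding special_isometry_group_def by auto
  have O: "carrier (isometry_group F) = ?O" using F(1) unfolding isometry_group_def by auto
  have neg: "- A \<in> ?S" "det A = - 1" if "A \<in> ?O" "det A \<noteq> 1" for A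
  proof -
    show det: "det A = - 1" using isometry_det[OF F(1,2)] that by blast
    have "- A = (- 1) \<cdot>\<^sub>m A" by auto
    then have "det (- A) = (- 1) ^ n * det A" using that(1) by (auto dest: carrier_matD(2))
    then have "det (- A) = 1" using det F(3) by simp
    moreover have "(- A)\<^sup>T * F * (- A) = F"
    proof -
      have "dim_row A = n" "dim_col A = n" "dim_row F = n" "dim_col F = n" "A\<^sup>T * F * A = F"
        using that(1) F(1) by auto
      then show ?thesis by (simp add: transpose_uminus)
    qed
    ultimately show "- A \<in> ?S" unfolding S using that(1) by auto
  qed
  have dmult: "det (A * A') = det A * det A'" if "A \<in> ?O" "A' \<in> ?O" for A A'
    using that det_mult[of A n A'] by simp
  have dd: "of_int \<delta> * of_int \<delta> = (1 :: complex)" using \<delta> by auto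
  let ?t = "\<lambda>A. if det A = 1 then r A else of_int \<delta> \<cdot>\<^sub>m r (- A)"
  have carr: "?t A \<in> carrier_mat d d" if "A \<in> ?O" for A
    using that neg r(1) S by auto
  have mult: "r (A * A') = r A * r A'" if "A \<in> ?S" "A' \<in> ?S" for A A'
    using r(3)[OF that] unfolding special_isometry_group_def by simp
  have tmult: "?t (A * A') = ?t A * ?t A'" if A: "A \<in> ?O" "A' \<in> ?O" for A A'
  proof -
    have dims: "dim_col A = dim_row A'" using A by auto
    show ?thesis
    proof (cases "det A = 1"; cases "det A' = 1")
      assume d: "det A = 1" "det A' = 1"
      then show ?thesis using A dmult[OF A] mult[of A A'] S by simp
    next
      assume d: "det A = 1" "det A' \<noteq> 1"
      have "- (A * A') = A * - A'" using dims by simp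
      then show ?thesis using d A dmult[OF A] mult[of A "- A'"] S neg[OF A(2) d(2)] r(1)
        by (simp add: mult_smult_distrib[of _ d d _ d])
    next
      assume d: "det A \<noteq> 1" "det A' = 1"
      have "- (A * A') = - A * A'" using dims by simp
      then show ?thesis using d A dmult[OF A] mult[of "- A" A'] S neg[OF A(1) d(1)] r(1)
        by (simp add: mult_smult_assoc_mat[of _ d d _ d])
    next
      assume d: "det A \<noteq> 1" "det A' \<noteq> 1"
      have "A * A' = - A * - A'" using dims by simp
      then have "r (A * A') = r (- A) * r (- A')"
        using mult[OF neg(1)[OF A(1) d(1)] neg(1)[OF A(2) d(2)]] by simp
      moreover have "det (A * A') = 1" using dmult[OF A] neg(2)[OF A(1) d(1)] neg(2)[OF A(2) d(2)] by simp
      moreover have c: "r (- A) \<in> carrier_mat d d" "r (- A') \<in> carrier_mat d d"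
        using r(1) neg(1) A d by auto
      have "(of_int \<delta> \<cdot>\<^sub>m r (- A)) * (of_int \<delta> \<cdot>\<^sub>m r (- A')) = r (- A) * r (- A')"
        using c dd by (auto simp: mult_smult_distrib[of _ d d _ d] mult_smult_assoc_mat[of _ d d _ d]
            mult.assoc[symmetric] intro!: eq_matI)
      ultimately show ?thesis using d by simp
    qed
  qed
  have ext: "sign_extension \<delta> R = (d, ?t)" by (simp only: sign_extension_def dr fst_conv snd_conv)
  have one: "?t \<one>\<^bsub>isometry_group F\<^esub> = 1\<^sub>m d"
    using r(2) F(1) by (simp add: isometry_group_def special_isometry_group_def)
  have mult_eq: "A \<otimes>\<^bsub>isometry_group F\<^esub> A' = A * A'" for A A' by (simp add: isometry_group_def)
  show ?thesis unfolding is_rep_def ext prod.case O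
  proof (intro conjI ballI)
    show "?t A \<in> carrier_mat d d" if "A \<in> ?O" for A using that by (rule carr)
    show "?t \<one>\<^bsub>isometry_group F\<^esub> = 1\<^sub>m d" by (rule one)
    show "?t (A \<otimes>\<^bsub>isometry_group F\<^esub> A') = ?t A * ?t A'" if "A \<in> ?O" "A' \<in> ?O" for A A'
      unfolding mult_eq using that by (rule tmult)
  qed
qed

section \<open>The eta and zeta correspondences\<close>

text \<open>The plain recipe yields zero unless the datum is constructible, and then the virtual recipe
  agrees with it by definition.\<close>

lemma virtual_recipe_eq_recipe:
  "run_recipe R \<noteq> 0 \<Longrightarrow> run_virtual_recipe R = run_recipe R"
  by (cases R) (auto split: if_splits)

lemma keys_run_virtual_recipe:
  "Poly_Mapping.keys (run_virtual_recipe R) \<subseteq> range (snd (snd (snd R)))"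
  by (cases R) (auto simp: keys_cmul dest!: subsetD[OF keys_cmul])

text \<open>Whatever the altered symbol and semisimple class are, the recipe ends with a value of the
  parametrization, and all its values are irreducible.\<close>

lemma eta_recipe_range:
  assumes "range (sp_rep P) \<subseteq> Irr H"
  shows "range (snd (snd (snd (eta_recipe J B P \<pi>)))) \<subseteq> Irr H"
  using assms
  by (auto simp: eta_recipe_def eta_recipe_odd_def eta_recipe_even_def Let_def split: prod.splits)

lemma torus_sign_cases:
  fixes F :: "'a::{field,finite} mat"
  assumes "torus_sign F s e"
  shows "e = 1 \<or> e = - 1"
proof -
  have signs: "prod_list (map f xs) \<in> {1, - 1}" if "\<And>x. f x \<in> {1, - 1}"
    for f :: "nat \<times> int \<times> 'a alg_closure \<Rightarrow> int" and xs
  proof (induction xs)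
    case (Cons x xs)
    then show ?case using that[of x] by auto
  qed simp
  obtain xs :: "(nat \<times> int \<times> 'a alg_closure) list" where "e = (\<Prod>(k, \<sigma>, x) \<leftarrow> xs.
      if x ^ (nat (int (CARD('a) ^ k) - \<sigma>) div 2) = 1 then 1 else - 1)"
    using assms unfolding torus_sign_def by blast
  then have "e \<in> {1, - 1}" by (simp only:) (rule signs, simp split: prod.split)
  then show ?thesis by simp
qed

text \<open>For even-dimensional \<open>B\<close> the recipe ends with a value of the parametrization. For odd-dimensional
  \<open>B\<close> it ends with an extension from \<open>SO\<close> by the sign \<open>\<epsilon>(s) disc(B)\<close>; this is \<open>\<plusminus>1\<close> because \<open>s\<close> lies in one
  of the semisimple classes on which \<open>\<epsilon>\<close> is a torus sign, which is where \<open>\<rho>\<close> being irreducible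
  enters.\<close>

lemma zeta_recipe_range:
  fixes J B :: "'f::{field,finite} mat"
  assumes P: "is_classification J B P" and B: "symmetric_form n B" and \<rho>: "\<rho> \<in> Irr (isometry_group J)"
  shows "range (snd (snd (snd (zeta_recipe J B P \<rho>)))) \<subseteq> rep_classes (isometry_group B)"
proof (cases "odd n")
  case False
  then have "range (o_rep P) \<subseteq> Irr (isometry_group B)"
    using P B unfolding is_classification_def symmetric_form_def parametrizes_def by (auto simp: Let_def)
  then have "range (o_rep P) \<subseteq> rep_classes (isometry_group B)"
    using Irr_subset_rep_classes by blast
  then show ?thesis using False B unfolding symmetric_form_def
    by (auto simp: zeta_recipe_def zeta_recipe_even_def Let_def split: prod.splits)
next
  case True
  define N where "N = dim_row J div 2"
  have Bn: "B \<in> carrier_mat n n" "det B \<noteq> 0" using B unfolding symmetric_form_def by auto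
  have bij: "bij_betw (sp_rep P) (sp_labels N) (Irr (isometry_group J))"
    using P unfolding is_classification_def parametrizes_def N_def by (auto simp: Let_def)
  have so: "range (so_rep P) \<subseteq> Irr (special_isometry_group B)"
    using P Bn True unfolding is_classification_def parametrizes_def by (auto simp: Let_def)
  obtain C u e where l: "the_inv_into (sp_labels N) (sp_rep P) \<rho> = (C, u, e)" by (metis prod_cases3)
  have "(C, u, e) \<in> sp_labels N"
    using the_inv_into_into[of "sp_rep P" "sp_labels N" \<rho> "sp_labels N"] bij \<rho> l
    unfolding bij_betw_def by auto
  then have "torus_sign (std_odd_orthogonal N) (elt C) (eps_so P C)"
    using P Bn True unfolding is_classification_def sp_labels_def N_def by (auto simp: Let_def)
  then have "eps_so P C = 1 \<or> eps_so P C = - 1" by (rule torus_sign_cases)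
  then have \<delta>: "eps_so P C * disc B = 1 \<or> eps_so P C * disc B = - 1"
    unfolding disc_def by auto
  have "odd_o_rep B P (eps_so P C * disc B, x) \<in> rep_classes (isometry_group B)" for x
  proof -
    have "so_rep P x \<in> rep_classes (special_isometry_group B)"
      using so Irr_subset_rep_classes by blast
    then show ?thesis
      using is_rep_sign_extension[OF Bn True \<delta> is_rep_some_member]
      unfolding odd_o_rep_def prod.case by (blast intro: rep_classesI)
  qed
  then show ?thesis using True Bn l
    by (auto simp: zeta_recipe_def zeta_recipe_odd_def Let_def N_def split: prod.splits)
qed

theorem proposition4p6p1:
  fixes J B :: "'f::{field,finite} mat" and N n :: nat
    and P :: "('f, 'f alg_closure) classification"
  assumes "odd CARD('f)"
    and "symplectic_form N J" and "symmetric_form n B"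
    and "is_classification J B P"
  shows "(symplectic_metastable N n \<longrightarrow>
      (\<forall>\<pi> \<in> Irr (isometry_group B). eta J B P \<pi> \<noteq> 0 \<longrightarrow>
        (\<forall>g \<in> carrier (isometry_group J).
          \<chi> (eta J B P \<pi>) g =
            (\<Sum>C \<in> conj_classes (isometry_group B).
               of_nat (card C) / of_nat (Coset.order (isometry_group B)) *
               cnj (\<chi> (frag_of \<pi>) (elt C)) * \<chi> (omega_top J B P) (g, elt C))))) \<and>
    (orthogonal_metastable N n B \<longrightarrow>
      (\<forall>\<rho> \<in> Irr (isometry_group J). zeta J B P \<rho> \<noteq> 0 \<longrightarrow>
        (\<forall>h \<in> carrier (isometry_group B).
          \<chi> (zeta J B P \<rho>) h =
            (\<Sum>C \<in> conj_classes (isometry_group J).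
               of_nat (card C) / of_nat (Coset.order (isometry_group J)) *
               cnj (\<chi> (frag_of \<rho>) (elt C)) * \<chi> (omega_top' J B P) (elt C, h)))))"
proof -
  let ?Sp = "isometry_group J" and ?O = "isometry_group B"
  have Sp: "group ?Sp" "finite (carrier ?Sp)"
    using assms(2) group_isometry_group finite_isometry_group unfolding symplectic_form_def by blast+
  have O: "group ?O" "finite (carrier ?O)"
    using assms(3) group_isometry_group finite_isometry_group unfolding symmetric_form_def by blast+
  have "range (sp_rep P) \<subseteq> Irr ?Sp"
    using assms(4) unfolding is_classification_def parametrizes_def by (auto simp: Let_def)
  then have eta_keys: "Poly_Mapping.keys (virtual_eta J B P \<pi>) \<subseteq> rep_classes ?Sp" for \<pi>
    unfolding virtual_eta_def
    using keys_run_virtual_recipe eta_recipe_range Irr_subset_rep_classes by (meson subset_trans)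
  have zeta_keys: "Poly_Mapping.keys (virtual_zeta J B P \<rho>) \<subseteq> rep_classes ?O" if "\<rho> \<in> Irr ?Sp" for \<rho>
    unfolding virtual_zeta_def
    using keys_run_virtual_recipe zeta_recipe_range[OF assms(4,3) that] by (rule subset_trans)
  have eta_eq: "virtual_eta J B P \<pi> = eta J B P \<pi>" if "eta J B P \<pi> \<noteq> 0" for \<pi>
    using that unfolding virtual_eta_def eta_def by (rule virtual_recipe_eq_recipe)
  have zeta_eq: "virtual_zeta J B P \<rho> = zeta J B P \<rho>" if "zeta J B P \<rho> \<noteq> 0" for \<rho>
    using that unfolding virtual_zeta_def zeta_def by (rule virtual_recipe_eq_recipe)
  show ?thesis
    unfolding omega_top_def omega_top'_def
  proof (intro conjI impI ballI)
    fix \<pi> g assume "\<pi> \<in> Irr ?O" "eta J B P \<pi> \<noteq> 0" "g \<in> carrier ?Sp"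
    then show "\<chi> (eta J B P \<pi>) g = (\<Sum>C\<in>conj_classes ?O. of_nat (card C) / of_nat (Coset.order ?O) *
        cnj (\<chi> (frag_of \<pi>) (elt C)) *
        \<chi> (\<Sum>\<pi>\<in>Irr ?O. virtual_tensor ?Sp ?O (virtual_eta J B P \<pi>) (frag_of \<pi>)) (g, elt C))"
      using virtual_char_tensor_sum_right[where V = "virtual_eta J B P" and c = \<pi> and g = g, OF O _ _ eta_keys]
      by (simp add: eta_eq)
  next
    fix \<rho> h assume "\<rho> \<in> Irr ?Sp" "zeta J B P \<rho> \<noteq> 0" "h \<in> carrier ?O"
    then show "\<chi> (zeta J B P \<rho>) h = (\<Sum>C\<in>conj_classes ?Sp. of_nat (card C) / of_nat (Coset.order ?Sp) *
        cnj (\<chi> (frag_of \<rho>) (elt C)) *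
        \<chi> (\<Sum>\<rho>\<in>Irr ?Sp. virtual_tensor ?Sp ?O (frag_of \<rho>) (virtual_zeta J B P \<rho>)) (elt C, h))"
      using virtual_char_tensor_sum_left[where V = "virtual_zeta J B P" and c = \<rho> and h = h, OF Sp _ _ zeta_keys]
      by (simp add: zeta_eq)
  qed
qed

end
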